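(* Let $n\ge2$, $1\le i\le n$, and let the channel gains $\vec h_i=(h_{j,i})_{j=1}^n$ be nonzero complex numbers. Let $\mathsf{C}_i^{(\mathrm{lb})}(\vec h_i)$ be the rate lower bound defined in the context. Then, regulating its transmission rate at $\mathsf{C}_i^{(\mathrm{lb})}(\vec h_i)$, the $i$-th user achieves the SNR scaling $$\lim_{\gamma\to\infty}\frac{\mathsf{C}_i^{(\mathrm{lb})}(\vec h_i)}{\log\gamma}=\frac{\Pr\{\vec{\boldsymbol{s}}_i\notin\mathrm{csp}(\boldsymbol{S}_i)\}}{K},$$ where $\mathrm{csp}(\boldsymbol{S}_i)$ denotes the column space of the matrix $\boldsymbol{S}_i$.
   Context: Logarithms are base 2. Fix an integer $K\ge1$, a finite alphabet $\mathscr{A}\subset\mathbb{Z}\setminus\{0\}$ with $\mathscr{A}=-\mathscr{A}$, a probability mass function $(\mathsf{p}_a)_{a\in\mathscr{A}}$ and $\varepsilon\in(0,1]$. The signature codes $\vec{\boldsymbol{s}}_1,\dots,\vec{\boldsymbol{s}}_n$ are i.i.d. $K\times1$ random vectors, each being the element-wise product of a vector with i.i.d. entries of law $(\mathsf{p}_a)$ and an independent vector with i.i.d. Bernoulli entries equal to $1$ with probability $\varepsilon$ and $0$ otherwise. Put $$\boldsymbol{S}_i=\big(\vec{\boldsymbol{s}}_1\ \cdots\ \vec{\boldsymbol{s}}_{i-1}\ \vec{\boldsymbol{s}}_{i+1}\ \cdots\ \vec{\boldsymbol{s}}_n\big),\qquad \Xi_i=\mathrm{diag}(h_{1,i},\dots,h_{i-1,i},h_{i+1,i},\dots,h_{n,i}),$$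 and let $\beta>0$ satisfy $\beta^2\mathrm{E}\{\|\vec{\boldsymbol{s}}_i\|_2^2\}=1$. $\mathrm{supp}(\cdot)$ is the set of values taken with positive probability, $\mathrm{H}(\cdot)$ is the entropy of a discrete random object, and $\dagger$ is conjugate transpose. The parameter $\gamma>0$ is the SNR. For nonzero $\vec s\in\mathbb{R}^K$, let $G_i(\vec s)$ be a $K\times(K-1)$ real matrix whose columns together with $\vec s/\|\vec s\|_2$ form an orthonormal basis of $\mathbb{R}^K$ (for $K=1$ the matrix is empty and the corresponding determinant below is $1$). Define $$\varrho_i(\gamma;\vec s)=\frac{|h_{i,i}|^2\|\vec s\|_2^2\,\gamma}{\mathrm{E}\{\|\vec{\boldsymbol{s}}_i\|_2^2\}}\prod_{S\in\mathrm{supp}(\boldsymbol{S}_i)}\left(\frac{\det\big(I_{K-1}+\beta^2\gamma\,G_i^\dagger(\vec s)S\Xi_i\Xi_i^\dagger S^\dagger G_i(\vec s)\big)}{\det\big(I_K+\beta^2\gamma\,S\Xi_i\Xi_i^\dagger S^\dagger\big)}\right)^{\Pr\{\boldsymbol{S}_i=S\}}$$ and $$\mathsf{C}_i^{(\mathrm{lb})}(\vec h_i)=\frac1K\sum_{\vec s\in\mathrm{supp}(\vec{\boldsymbol{s}}_i)\setminus\{0\}}\Pr\{\vec{\boldsymbol{s}}_i=\vec s\}\log\left(2^{-\mathrm{H}\left(\sum_{j\ne i}|h_{j,i}|^2\vec{\boldsymbol{s}}_j\vec{\boldsymbol{s}}_j^\dagger\right)}\varrho_i(\gamma;\vec s)+1\right).$$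 *)

theory Defs
  imports
    "HOL-Probability.Probability"
    "Jordan_Normal_Form.VS_Connect"
    "Jordan_Normal_Form.Schur_Decomposition"
begin

no_notation inner (infix "\<bullet>" 70)
no_notation vec_nth (infixl "$" 90)

text \<open>
  Vectors and matrices are the dimension-carrying ones of \<open>Jordan_Normal_Form\<close>, so that
  $K \times (K-1)$ matrices are available for variable \<open>K\<close>. Users are numbered from 1 to \<open>n\<close>,
  coordinates from 0 to \<open>K - 1\<close>. Random objects live on a probability space \<open>M\<close>. The signature
  codes are integer vectors, hence take values in a countable type, so that every event expressed
  through them is measurable.
\<close>

abbreviation real_vec :: "int vec \<Rightarrow> real vec" where
  "real_vec \<equiv> map_vec real_of_int"

abbreviation cmplx_mat :: "int mat \<Rightarrow> complex mat" where
  "cmplx_mat \<equiv> map_mat complex_of_int"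

definition vec_norm :: "real vec \<Rightarrow> real" where
  "vec_norm v = sqrt (v \<bullet> v)"

definition supp :: "'w measure \<Rightarrow> ('w \<Rightarrow> 'b) \<Rightarrow> 'b set" where
  "supp M X = {x. measure M {w \<in> space M. X w = x} > 0}"

text \<open>
  Entropy in bits. The whole type serves as value space, rather than \<open>X ` space M\<close> as in the
  library's notation, because \<open>X\<close> may take infinitely many values with probability zero.
\<close>

definition discrete_entropy :: "'w measure \<Rightarrow> ('w \<Rightarrow> 'b) \<Rightarrow> real" where
  "discrete_entropy M X = prob_space.entropy M 2 (count_space UNIV) X"

lemma discrete_entropy_eq:
  assumes "prob_space M" and X: "X \<in> measurable M (count_space UNIV)"
    and fin: "finite (supp M X)" and ae: "AE w in M. X w \<in> supp M X"
  shows "discrete_entropy M X =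
    - (\<Sum>x\<in>supp M X. measure M {w \<in> space M. X w = x} * log 2 (measure M {w \<in> space M. X w = x}))"
proof -
  interpret information_space M 2
    using assms(1) by (simp add: information_space_def information_space_axioms_def)
  note [measurable] = X
  let ?f = "\<lambda>x. measure M {w \<in> space M. X w = x}"
  have z: "?f x = 0" if "x \<notin> supp M X" for x
    using that measure_nonneg[of M "{w \<in> space M. X w = x}"] unfolding supp_def
    by (simp add: not_less order_antisym)
  have "distr M (count_space UNIV) X = density (count_space UNIV) (\<lambda>x. ennreal (?f x))"
  proof (rule measure_eqI)
    fix B assume "B \<in> sets (distr M (count_space UNIV) X)"
    let ?B = "B \<inter> supp M X"
    have "emeasure M (X -` B \<inter> space M) = emeasure M (X -` ?B \<inter> space M)"
      using ae by (intro emeasure_eq_AE measurable_sets[OF X]) auto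
    also have "X -` ?B \<inter> space M = (\<Union>x\<in>?B. {w \<in> space M. X w = x})"
      by auto
    also have "emeasure M \<dots> = (\<Sum>x\<in>?B. emeasure M {w \<in> space M. X w = x})"
      using fin by (intro sum_emeasure[symmetric]) (auto simp: disjoint_family_on_def)
    also have "\<dots> = (\<Sum>x\<in>?B. ennreal (?f x))"
      by (simp add: emeasure_eq_measure)
    also have "\<dots> = (\<integral>\<^sup>+x. ennreal (?f x) * indicator B x \<partial>count_space UNIV)"
      using fin z by (subst nn_integral_count_space'[of ?B]) (auto simp: indicator_def intro!: sum.cong)
    finally show "emeasure (distr M (count_space UNIV) X) B =
        emeasure (density (count_space UNIV) (\<lambda>x. ennreal (?f x))) B"
      by (simp add: emeasure_distr emeasure_density)
  qed simp
  then have "distributed M (count_space UNIV) X (\<lambda>x. ennreal (?f x))"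
    by (simp add: distributed_def)
  then have "discrete_entropy M X = - (\<integral>x. ?f x * log 2 (?f x) \<partial>count_space UNIV)"
    unfolding discrete_entropy_def by (intro entropy_distr) auto
  also have "(\<integral>x. ?f x * log 2 (?f x) \<partial>count_space UNIV) = (\<Sum>x\<in>supp M X. ?f x * log 2 (?f x))"
    using fin z by (subst lebesgue_integral_count_space_finite_support)
      (auto intro!: sum.mono_neutral_left finite_subset[OF _ fin])
  finally show ?thesis by simp
qed

definition code_pmf :: "nat \<Rightarrow> int pmf \<Rightarrow> real \<Rightarrow> int vec pmf" where
  "code_pmf K p \<epsilon> =
     map_pmf (\<lambda>(x, b). Matrix.vec K (\<lambda>k. x k * of_bool (b k)))
       (pair_pmf (Pi_pmf {..<K} 0 (\<lambda>_. p)) (Pi_pmf {..<K} False (\<lambda>_. bernoulli_pmf \<epsilon>)))"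

definition others :: "nat \<Rightarrow> nat \<Rightarrow> nat list" where
  "others n i = filter (\<lambda>j. j \<noteq> i) [1..<Suc n]"

definition code_mat :: "nat \<Rightarrow> nat \<Rightarrow> nat \<Rightarrow> (nat \<Rightarrow> 'w \<Rightarrow> int vec) \<Rightarrow> 'w \<Rightarrow> int mat" where
  "code_mat K n i s w = mat_of_cols K (map (\<lambda>j. s j w) (others n i))"

definition gain_mat :: "nat \<Rightarrow> nat \<Rightarrow> (nat \<Rightarrow> complex) \<Rightarrow> complex mat" where
  "gain_mat n i h = mat_diag (n - 1) (\<lambda>l. h (others n i ! l))"

definition csp :: "nat \<Rightarrow> int mat \<Rightarrow> real vec set" where
  "csp K S = vec_space.col_space K (map_mat real_of_int S)"

definition mean_energy :: "'w measure \<Rightarrow> ('w \<Rightarrow> int vec) \<Rightarrow> real" where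
  "mean_energy M X = (\<integral>w. (vec_norm (real_vec (X w)))\<^sup>2 \<partial>M)"

definition interference_cov ::
  "nat \<Rightarrow> nat \<Rightarrow> nat \<Rightarrow> (nat \<Rightarrow> complex) \<Rightarrow> (nat \<Rightarrow> 'w \<Rightarrow> int vec) \<Rightarrow> 'w \<Rightarrow> real mat" where
  "interference_cov K n i h s w =
     Matrix.mat K K (\<lambda>(a, b). \<Sum>j\<in>{1..n} - {i}.
       (cmod (h j))\<^sup>2 * (vec_index (real_vec (s j w)) a * vec_index (real_vec (s j w)) b))"

definition orthonormal_basis :: "nat \<Rightarrow> real vec list \<Rightarrow> bool" where
  "orthonormal_basis K vs \<longleftrightarrow>
     vectorspace.basis class_ring (module_vec TYPE(real) K) (set vs) \<and>
     (\<forall>a<length vs. \<forall>b<length vs. vs ! a \<bullet> vs ! b = of_bool (a = b))"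

definition is_complement :: "nat \<Rightarrow> real vec \<Rightarrow> real mat \<Rightarrow> bool" where
  "is_complement K v G \<longleftrightarrow>
     G \<in> carrier_mat K (K - 1) \<and> orthonormal_basis K (cols G @ [(1 / vec_norm v) \<cdot>\<^sub>v v])"

text \<open>
  In the next two definitions the matrices are Hermitian, so the determinants are real.
\<close>

definition det_full :: "nat \<Rightarrow> real \<Rightarrow> int mat \<Rightarrow> complex mat \<Rightarrow> real" where
  "det_full K c S \<Xi> = Re (Determinant.det (1\<^sub>m K + complex_of_real c \<cdot>\<^sub>m
     (cmplx_mat S * \<Xi> * mat_adjoint \<Xi> * mat_adjoint (cmplx_mat S))))"

definition det_proj :: "nat \<Rightarrow> real \<Rightarrow> real mat \<Rightarrow> int mat \<Rightarrow> complex mat \<Rightarrow> real" where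
  "det_proj K c G S \<Xi> = Re (Determinant.det (1\<^sub>m (K - 1) + complex_of_real c \<cdot>\<^sub>m
     (mat_adjoint (map_mat complex_of_real G) * cmplx_mat S * \<Xi> * mat_adjoint \<Xi> *
      mat_adjoint (cmplx_mat S) * map_mat complex_of_real G)))"

definition varrho ::
  "'w measure \<Rightarrow> nat \<Rightarrow> nat \<Rightarrow> nat \<Rightarrow> (nat \<Rightarrow> complex) \<Rightarrow> (nat \<Rightarrow> 'w \<Rightarrow> int vec) \<Rightarrow> real \<Rightarrow>
   (real vec \<Rightarrow> real mat) \<Rightarrow> real \<Rightarrow> real vec \<Rightarrow> real" where
  "varrho M K n i h s \<beta> G \<gamma> v =
     (cmod (h i))\<^sup>2 * (vec_norm v)\<^sup>2 * \<gamma> / mean_energy M (s i) *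
     (\<Prod>S\<in>supp M (code_mat K n i s).
        (det_proj K (\<beta>\<^sup>2 * \<gamma>) (G v) S (gain_mat n i h) /
         det_full K (\<beta>\<^sup>2 * \<gamma>) S (gain_mat n i h))
        powr measure M {w \<in> space M. code_mat K n i s w = S})"

definition C_lb ::
  "'w measure \<Rightarrow> nat \<Rightarrow> nat \<Rightarrow> nat \<Rightarrow> (nat \<Rightarrow> complex) \<Rightarrow> (nat \<Rightarrow> 'w \<Rightarrow> int vec) \<Rightarrow> real \<Rightarrow>
   (real vec \<Rightarrow> real mat) \<Rightarrow> real \<Rightarrow> real" where
  "C_lb M K n i h s \<beta> G \<gamma> =
     1 / real K * (\<Sum>v\<in>supp M (s i) - {0\<^sub>v K}.
       measure M {w \<in> space M. s i w = v} *
       log 2 (2 powr (- discrete_entropy M (interference_cov K n i h s)) *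
              varrho M K n i h s \<beta> G \<gamma> (real_vec v) + 1))"

end

theory Submission
  imports Defs "HOL-Real_Asymp.Real_Asymp"
begin

text \<open>
  Let \<open>u\<close> be the normalised vector \<open>v\<close> and let \<open>A\<close> be \<open>S\<close> with its columns scaled by the moduli of
  the channel gains. By Cramer's rule in an orthonormal basis ending with \<open>u\<close>, the quotient of
  determinants belonging to \<open>S\<close> is the resolvent entry \<open>r = u \<bullet> (I + t A A\<^sup>T)\<^sup>-\<^sup>1 u\<close> with
  \<open>t = \<beta>\<^sup>2 \<gamma>\<close>. Always \<open>1 / (1 + t |A\<^sup>T u|\<^sup>2) \<le> r \<le> 1\<close>. If \<open>u = A y\<close>, then also
  \<open>r \<le> |y|\<^sup>2 / t\<close>, so \<open>r\<close> is of order \<open>1 / t\<close>; if \<open>u\<close> is outside the column space, some \<open>z\<close> with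
  \<open>A\<^sup>T z = 0\<close> and \<open>z \<bullet> u \<noteq> 0\<close> keeps \<open>r\<close> away from 0. Hence the summand of \<open>v\<close> grows like
  \<open>log \<gamma>\<close> times the probability that \<open>v\<close> is outside the column space, and the independence of
  \<open>s i\<close> from the other codes turns the average over \<open>v\<close> into the claimed probability.
\<close>

section \<open>Bounds on the resolvent of a Gram matrix\<close>

lemma (in vec_space) separating_functional:
  assumes "set cs \<subseteq> carrier_vec n" and "u \<in> carrier_vec n" and "u \<notin> span (set cs)"
  shows "\<exists>z\<in>carrier_vec n. (\<forall>v\<in>set cs. z \<bullet> v = 0) \<and> z \<bullet> u \<noteq> 0"
  using assms
proof (induction cs arbitrary: u)
  case Nil
  then have "u \<noteq> 0\<^sub>v n"
    by (auto simp: span_empty)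
  then obtain k where k: "k < n" "u $ k \<noteq> 0"
    using Nil.prems(2) by (metis carrier_vecD eq_vecI index_zero_vec)
  with Nil.prems show ?case
    by (intro bexI[of _ "unit_vec n k"]) auto
next
  case (Cons v cs)
  have v: "v \<in> carrier_vec n" and cs: "set cs \<subseteq> carrier_vec n" and u: "u \<in> carrier_vec n"
    using Cons.prems by auto
  have mono: "span (set cs) \<subseteq> span (set (v # cs))"
    by (intro span_is_monotone) auto
  show ?case
  proof (cases "v \<in> span (set cs)")
    case True
    then have "span (set (v # cs)) = span (set cs)"
      using already_in_span[of "set cs" v] cs by auto
    then obtain z where z: "z \<in> carrier_vec n" "\<forall>w\<in>set cs. z \<bullet> w = 0" "z \<bullet> u \<noteq> 0"
      using Cons.IH[OF cs u] Cons.prems(3) by auto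
    \<comment> \<open>Vanishing on the generators extends to the whole span, hence to
      \<open>v\<close>.\<close>
    have "z \<in> orthogonal_complement (span (set cs))"
      unfolding in_orthogonal_complement_span[OF cs] using z by (simp add: orthogonal_complement_def)
    then have "z \<bullet> v = 0"
      using True by (auto simp: orthogonal_complement_def)
    then show ?thesis using z by auto
  next
    case False
    from Cons.IH[OF cs v False] obtain z0 where
      z0: "z0 \<in> carrier_vec n" "\<forall>w\<in>set cs. z0 \<bullet> w = 0" "z0 \<bullet> v \<noteq> 0" by auto
    \<comment> \<open>\<open>c\<close> makes \<open>z0\<close> vanish on \<open>u'\<close>. Since
      \<open>u'\<close> differs from \<open>u\<close> by a multiple of \<open>v\<close>, it is still
      outside the span of \<open>cs\<close>.\<close>
    define c where "c = (z0 \<bullet> u) / (z0 \<bullet> v)"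
    define u' where "u' = u + (- c) \<cdot>\<^sub>v v"
    have u': "u' \<in> carrier_vec n" using u v by (simp add: u'_def)
    have z0u': "z0 \<bullet> u' = 0"
      using z0 u v by (simp add: u'_def c_def scalar_prod_add_distrib[of _ n])
    have ueq: "u = u' + c \<cdot>\<^sub>v v"
      using u v by (auto simp: u'_def)
    have "v \<in> span (set (v # cs))"
      using Cons.prems(1) span_mem by auto
    then have cv: "c \<cdot>\<^sub>v v \<in> span (set (v # cs))"
      by (rule smult_in_span[OF Cons.prems(1)])
    have "u' \<notin> span (set cs)"
      using Cons.prems(1,3) mono cv ueq span_add1[of "set (v # cs)" u' "c \<cdot>\<^sub>v v"] by auto
    from Cons.IH[OF cs u' this] obtain z1 where
      z1: "z1 \<in> carrier_vec n" "\<forall>w\<in>set cs. z1 \<bullet> w = 0" "z1 \<bullet> u' \<noteq> 0" by auto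
    \<comment> \<open>\<open>d\<close> cancels the value at \<open>v\<close>; the value at
      \<open>u'\<close> stays that of \<open>z1\<close>, because
      \<open>z0 \<bullet> u' = 0\<close>.\<close>
    define d where "d = (z1 \<bullet> v) / (z0 \<bullet> v)"
    define z where "z = z1 + (- d) \<cdot>\<^sub>v z0"
    have sp: "z \<bullet> w = z1 \<bullet> w - d * (z0 \<bullet> w)" if "w \<in> carrier_vec n" for w
      using that z0 z1 by (simp add: z_def add_scalar_prod_distrib[of _ n])
    have zc: "z \<in> carrier_vec n" using z0 z1 by (simp add: z_def)
    have zv: "z \<bullet> v = 0" using sp[OF v] z0 by (simp add: d_def)
    have "z \<bullet> u = z \<bullet> u' + c * (z \<bullet> v)"
      using zc u' v by (subst ueq) (simp add: scalar_prod_add_distrib[of _ n])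
    then have "z \<bullet> u \<noteq> 0"
      using zv sp[OF u'] z0u' z1 by simp
    moreover have "z \<bullet> w = 0" if "w \<in> set cs" for w
      using that cs sp[of w] z0 z1 by auto
    ultimately show ?thesis using zc zv by auto
  qed
qed

text \<open>The rows of \<open>A\<^sup>T\<close> are the columns of \<open>A\<close>, so a
  separating functional is a kernel vector of \<open>A\<^sup>T\<close>. In this form it can be
  paired with the linear system of the resolvent.\<close>

lemma outside_col_space_witness:
  fixes A :: "'a :: field mat"
  assumes A: "A \<in> carrier_mat K m" and u: "u \<in> carrier_vec K"
    and "u \<notin> vec_space.col_space K A"
  obtains z where "z \<in> carrier_vec K" "A\<^sup>T *\<^sub>v z = 0\<^sub>v m" "z \<bullet> u \<noteq> 0"
proof -
  interpret vec_space "TYPE('a)" K .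
  have "set (cols A) \<subseteq> carrier_vec K" using A cols_dim[of A] by auto
  from separating_functional[OF this u] assms(3) obtain z where
    z: "z \<in> carrier_vec K" "\<forall>v\<in>set (cols A). z \<bullet> v = 0" "z \<bullet> u \<noteq> 0"
    unfolding col_space_def by auto
  have "A\<^sup>T *\<^sub>v z = 0\<^sub>v m"
  proof (rule eq_vecI)
    fix l assume l: "l < dim_vec (0\<^sub>v m)"
    then have "col A l \<bullet> z = z \<bullet> col A l"
      using A z(1) by (intro comm_scalar_prod[of _ K]) auto
    then show "(A\<^sup>T *\<^sub>v z) $ l = 0\<^sub>v m $ l"
      using l A z(2) by (auto simp: cols_def)
  qed (use A in auto)
  with z that show thesis by blast
qed

section \<open>Real scalar products and the quadratic form of
  \<open>I + t A A\<^sup>T\<close>\<close>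

lemma scalar_prod_self_nonneg: "0 \<le> x \<bullet> (x :: real vec)"
  by (auto simp: scalar_prod_def intro!: sum_nonneg)

lemma scalar_prod_self_pos:
  fixes x :: "real vec"
  assumes "x \<in> carrier_vec n" "x \<noteq> 0\<^sub>v n"
  shows "0 < x \<bullet> x"
proof -
  obtain k where "k < n" "x $ k \<noteq> 0"
    using assms by (metis carrier_vecD eq_vecI index_zero_vec)
  then have "0 < (\<Sum>k = 0..<n. x $ k * x $ k)"
    by (intro sum_pos2[of _ k]) (auto simp: zero_less_mult_iff)
  then show ?thesis using assms by (simp add: scalar_prod_def)
qed

lemma scalar_prod_Cauchy_Schwarz:
  fixes x y :: "real vec"
  assumes "x \<in> carrier_vec n" "y \<in> carrier_vec n"
  shows "(x \<bullet> y)\<^sup>2 \<le> (x \<bullet> x) * (y \<bullet> y)"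
  using Cauchy_Schwarz_ineq_sum[of "\<lambda>k. x $ k" "\<lambda>k. y $ k" "{0..<n}"] assms
  by (simp add: scalar_prod_def power2_eq_square)

lemma one_plus_gram_mult_vec:
  fixes A :: "real mat"
  assumes A: "A \<in> carrier_mat K m" and x: "x \<in> carrier_vec K"
  shows "(1\<^sub>m K + t \<cdot>\<^sub>m (A * A\<^sup>T)) *\<^sub>v x = x + t \<cdot>\<^sub>v (A *\<^sub>v (A\<^sup>T *\<^sub>v x))"
proof -
  have "(t \<cdot>\<^sub>m Q) *\<^sub>v x = t \<cdot>\<^sub>v (Q *\<^sub>v x)" if "Q \<in> carrier_mat K K" for Q
    using that x by (intro eq_vecI) auto
  then have "(t \<cdot>\<^sub>m (A * A\<^sup>T)) *\<^sub>v x = t \<cdot>\<^sub>v ((A * A\<^sup>T) *\<^sub>v x)"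
    using A by auto
  also have "(A * A\<^sup>T) *\<^sub>v x = A *\<^sub>v (A\<^sup>T *\<^sub>v x)"
    using A x by (intro assoc_mult_mat_vec[of _ K m _ K]) auto
  finally show ?thesis
    using A x by (subst add_mult_distrib_mat_vec[of _ K K]) auto
qed

lemma one_plus_gram_scalar_prod:
  fixes A :: "real mat"
  assumes A: "A \<in> carrier_mat K m" and x: "x \<in> carrier_vec K" and y: "y \<in> carrier_vec K"
  shows "y \<bullet> ((1\<^sub>m K + t \<cdot>\<^sub>m (A * A\<^sup>T)) *\<^sub>v x) = y \<bullet> x + t * ((A\<^sup>T *\<^sub>v y) \<bullet> (A\<^sup>T *\<^sub>v x))"
proof -
  have "y \<bullet> (A *\<^sub>v (A\<^sup>T *\<^sub>v x)) = (A\<^sup>T *\<^sub>v y) \<bullet> (A\<^sup>T *\<^sub>v x)"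
    using A x y by (intro transpose_vec_mult_scalar[symmetric]) auto
  then show ?thesis
    using A x y unfolding one_plus_gram_mult_vec[OF A x]
    by (subst scalar_prod_add_distrib[of _ K]) auto
qed

text \<open>A nonzero kernel vector \<open>x\<close> would make the quadratic form vanish, although
  the form is at least \<open>x \<bullet> x > 0\<close>.\<close>

lemma det_one_plus_gram_nonzero:
  fixes A :: "real mat"
  assumes A: "A \<in> carrier_mat K m" and t: "t \<ge> 0"
  shows "Determinant.det (1\<^sub>m K + t \<cdot>\<^sub>m (A * A\<^sup>T)) \<noteq> 0"
proof
  let ?B = "1\<^sub>m K + t \<cdot>\<^sub>m (A * A\<^sup>T)"
  assume "Determinant.det ?B = 0"
  moreover have "?B \<in> carrier_mat K K" using A by auto
  ultimately obtain x where x: "x \<in> carrier_vec K" "x \<noteq> 0\<^sub>v K" "?B *\<^sub>v x = 0\<^sub>v K"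
    using det_0_iff_vec_prod_zero_field by blast
  have "0 = x \<bullet> (?B *\<^sub>v x)" using x by simp
  also have "\<dots> = x \<bullet> x + t * ((A\<^sup>T *\<^sub>v x) \<bullet> (A\<^sup>T *\<^sub>v x))"
    using one_plus_gram_scalar_prod[OF A x(1) x(1)] .
  also have "\<dots> > 0"
    using scalar_prod_self_pos[OF x(1,2)] t scalar_prod_self_nonneg by (simp add: add_pos_nonneg)
  finally show False by simp
qed

section \<open>Upper and lower bounds for the resolvent entry \<open>u \<bullet> x\<close>\<close>

context
  fixes A :: "real mat" and K m :: nat and t :: real and u x :: "real vec"
  assumes A: "A \<in> carrier_mat K m" and t: "t > 0"
    and u: "u \<in> carrier_vec K" and unit: "u \<bullet> u = 1"
    and x: "x \<in> carrier_vec K" and sol: "(1\<^sub>m K + t \<cdot>\<^sub>m (A * A\<^sup>T)) *\<^sub>v x = u"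
begin

text \<open>The system is paired with its own solution. Both terms on the right are nonnegative, so
  \<open>u \<bullet> x\<close> dominates each of them; the upper bounds below rest on this.\<close>

lemma resolvent_energy: "u \<bullet> x = x \<bullet> x + t * ((A\<^sup>T *\<^sub>v x) \<bullet> (A\<^sup>T *\<^sub>v x))"
  using one_plus_gram_scalar_prod[OF A x x, of t] comm_scalar_prod[OF u x] by (simp add: sol)

text \<open>Nonnegativity of the quadratic form of \<open>I + t A A\<^sup>T\<close> at \<open>x - \<lambda> u\<close>, for the optimal \<open>\<lambda>\<close>.\<close>

lemma resolvent_lower: "1 / (1 + t * ((A\<^sup>T *\<^sub>v u) \<bullet> (A\<^sup>T *\<^sub>v u))) \<le> u \<bullet> x"
proof -
  let ?a = "A\<^sup>T *\<^sub>v x" and ?b = "A\<^sup>T *\<^sub>v u"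
  define q where "q = 1 + t * (?b \<bullet> ?b)"
  \<comment> \<open>By \<open>cross\<close>, the form at \<open>x - \<lambda> u\<close> is
    \<open>u \<bullet> x - 2 \<lambda> + \<lambda>\<^sup>2 q\<close>, which is minimal at
    \<open>\<lambda> = 1 / q\<close>.\<close>
  define w where "w = x + (- (1 / q)) \<cdot>\<^sub>v u"
  have q: "q > 0"
    using t scalar_prod_self_nonneg[of ?b] unfolding q_def by (smt (verit) mult_nonneg_nonneg)
  have a: "?a \<in> carrier_vec m" and b: "?b \<in> carrier_vec m" and w: "w \<in> carrier_vec K"
    using A x u by (auto simp: w_def)
  have cross: "1 = u \<bullet> x + t * (?b \<bullet> ?a)"
    using one_plus_gram_scalar_prod[OF A x u, of t] by (simp add: sol unit)
  have Aw: "A\<^sup>T *\<^sub>v w = ?a + (- (1 / q)) \<cdot>\<^sub>v ?b"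
    using A x u unfolding w_def by (subst mult_add_distrib_mat_vec[of _ m K]) (auto simp: mult_mat_vec)
  have expand: "(y + c \<cdot>\<^sub>v z) \<bullet> (y + c \<cdot>\<^sub>v z) = y \<bullet> y + 2 * c * (z \<bullet> y) + c\<^sup>2 * (z \<bullet> z)"
    if "y \<in> carrier_vec k" "z \<in> carrier_vec k" for y z :: "real vec" and c k
    using that comm_scalar_prod[of y k z]
    by (simp add: scalar_prod_add_distrib[of _ k] add_scalar_prod_distrib[of _ k] power2_eq_square algebra_simps)
  have "0 \<le> w \<bullet> w + t * ((A\<^sup>T *\<^sub>v w) \<bullet> (A\<^sup>T *\<^sub>v w))"
    using t scalar_prod_self_nonneg by simp
  also have "\<dots> = u \<bullet> x - 2 / q * (u \<bullet> x + t * (?b \<bullet> ?a)) + (1 / q)\<^sup>2 * (u \<bullet> u + t * (?b \<bullet> ?b))"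
    unfolding Aw unfolding w_def expand[OF x u] expand[OF a b] resolvent_energy
    by (simp add: algebra_simps)
  also have "\<dots> = u \<bullet> x - 1 / q"
    unfolding cross[symmetric] unit q_def[symmetric] using q by (simp add: power2_eq_square field_simps)
  finally show ?thesis unfolding q_def by simp
qed

text \<open>Cauchy-Schwarz against the unit vector and the energy identity give
  \<open>p\<^sup>2 \<le> p\<close> for \<open>p = u \<bullet> x\<close>, which forces
  \<open>p \<le> 1\<close>.\<close>

lemma resolvent_upper: "u \<bullet> x \<le> 1"
proof -
  have "(u \<bullet> x)\<^sup>2 \<le> x \<bullet> x"
    using scalar_prod_Cauchy_Schwarz[OF u x] unit by simp
  also have "\<dots> \<le> u \<bullet> x"
    unfolding resolvent_energy using t scalar_prod_self_nonneg by simp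
  finally have le: "u \<bullet> x * (u \<bullet> x) \<le> u \<bullet> x" by (simp add: power2_eq_square)
  show ?thesis
  proof (rule ccontr)
    assume "\<not> u \<bullet> x \<le> 1"
    then have "1 * (u \<bullet> x) < u \<bullet> x * (u \<bullet> x)"
      by (intro mult_strict_right_mono) auto
    with le show False by simp
  qed
qed

text \<open>Moving \<open>A\<close> to the other side gives
  \<open>u \<bullet> x = y \<bullet> A\<^sup>T x\<close>. Cauchy-Schwarz brings in
  \<open>A\<^sup>T x\<close>, whose squared norm times \<open>t\<close> is at most
  \<open>u \<bullet> x\<close>, and one positive factor \<open>u \<bullet> x\<close>
  cancels.\<close>

lemma resolvent_upper_inside:
  assumes y: "y \<in> carrier_vec m" and Ay: "A *\<^sub>v y = u"
  shows "t * (u \<bullet> x) \<le> y \<bullet> y"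
proof -
  let ?a = "A\<^sup>T *\<^sub>v x"
  have a: "?a \<in> carrier_vec m" using A x by auto
  have eq: "u \<bullet> x = y \<bullet> ?a"
    using transpose_vec_mult_scalar[OF A y x] comm_scalar_prod[OF u x] comm_scalar_prod[OF a y]
    by (simp add: Ay)
  have "t * (?a \<bullet> ?a) \<le> u \<bullet> x"
    unfolding resolvent_energy using scalar_prod_self_nonneg[of x] by simp
  moreover have "(u \<bullet> x)\<^sup>2 \<le> (y \<bullet> y) * (?a \<bullet> ?a)"
    unfolding eq by (rule scalar_prod_Cauchy_Schwarz[OF y a])
  ultimately have "t * (u \<bullet> x)\<^sup>2 \<le> (y \<bullet> y) * (u \<bullet> x)"
    using t scalar_prod_self_nonneg[of y]
    by (smt (verit, best) mult.assoc mult.left_commute mult_left_mono)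
  moreover have "u \<bullet> x > 0"
    using resolvent_lower t scalar_prod_self_nonneg[of "A\<^sup>T *\<^sub>v u"]
    by (smt (verit) divide_pos_pos mult_nonneg_nonneg)
  ultimately show ?thesis by (simp add: power2_eq_square)
qed

text \<open>A vector killed by \<open>A\<^sup>T\<close> does not see the Gram term, so
  \<open>z \<bullet> u = z \<bullet> x\<close>, and
  \<open>x \<bullet> x \<le> u \<bullet> x\<close>. The resulting bound does not involve
  \<open>t\<close>.\<close>

lemma resolvent_lower_outside:
  assumes z: "z \<in> carrier_vec K" and Az: "A\<^sup>T *\<^sub>v z = 0\<^sub>v m"
  shows "(z \<bullet> u)\<^sup>2 \<le> (z \<bullet> z) * (u \<bullet> x)"
proof -
  have "A\<^sup>T *\<^sub>v x \<in> carrier_vec m" using A x by auto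
  then have "z \<bullet> u = z \<bullet> x"
    using one_plus_gram_scalar_prod[OF A x z, of t] by (simp add: sol Az)
  then have "(z \<bullet> u)\<^sup>2 \<le> (z \<bullet> z) * (x \<bullet> x)"
    using scalar_prod_Cauchy_Schwarz[OF z x] by simp
  also have "\<dots> \<le> (z \<bullet> z) * (u \<bullet> x)"
    unfolding resolvent_energy using t scalar_prod_self_nonneg by (intro mult_left_mono) auto
  finally show ?thesis .
qed

end

section \<open>Orthonormal bases and Cramer's rule\<close>

text \<open>The scalar products of the basis vectors are the entries of
  \<open>U\<^sup>T * U\<close>; a left inverse of a square matrix is also a right inverse. The
  normalised \<open>v\<close> is put last, at index \<open>K - 1\<close>.\<close>

lemma is_complement_orthogonal:
  assumes K: "K \<ge> 1" and v: "v \<in> carrier_vec K" and G: "is_complement K v G"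
  defines "U \<equiv> mat_of_cols K (cols G @ [(1 / vec_norm v) \<cdot>\<^sub>v v])"
  shows "U \<in> carrier_mat K K" "U\<^sup>T * U = 1\<^sub>m K" "U * U\<^sup>T = 1\<^sub>m K"
    "\<And>b. b < K - 1 \<Longrightarrow> col U b = col G b" "col U (K - 1) = (1 / vec_norm v) \<cdot>\<^sub>v v"
proof -
  let ?cs = "cols G @ [(1 / vec_norm v) \<cdot>\<^sub>v v]"
  have Gc: "G \<in> carrier_mat K (K - 1)" and
    orth: "\<And>a b. a < length ?cs \<Longrightarrow> b < length ?cs \<Longrightarrow> ?cs ! a \<bullet> ?cs ! b = of_bool (a = b)"
    using G by (auto simp: is_complement_def orthonormal_basis_def)
  have len: "length ?cs = K" using Gc K by simp
  have car: "?cs ! b \<in> carrier_vec K" if "b < K" for b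
    using that Gc v K by (auto simp: nth_append)
  show U: "U \<in> carrier_mat K K" unfolding U_def using len by (metis mat_of_cols_carrier(1))
  have colU: "col U b = ?cs ! b" if "b < K" for b
    unfolding U_def using that len car by (intro col_mat_of_cols) auto
  show "col U b = col G b" if "b < K - 1" for b
    using that colU[of b] Gc by (simp add: nth_append)
  show "col U (K - 1) = (1 / vec_norm v) \<cdot>\<^sub>v v"
    using colU[of "K - 1"] Gc K by (simp add: nth_append)
  show UTU: "U\<^sup>T * U = 1\<^sub>m K"
    by (rule eq_matI) (use U colU orth len in auto)
  show "U * U\<^sup>T = 1\<^sub>m K"
    using mat_mult_left_right_inverse[OF _ U UTU] U by simp
qed

lemma mat_delete_last:
  assumes "A \<in> carrier_mat K K"
  shows "mat_delete A (K - 1) (K - 1) = Matrix.mat (K - 1) (K - 1) (\<lambda>(a, b). A $$ (a, b))"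
  using assms by (intro eq_matI) (auto simp: mat_delete_def)

text \<open>In the orthonormal basis formed by the columns of \<open>G\<close> and the normalised \<open>v\<close>, the smaller
  determinant is the last diagonal cofactor of the larger one, so Cramer's rule applies.\<close>

lemma cramer_resolvent:
  fixes A G :: "real mat" and v :: "real vec"
  assumes K: "K \<ge> 1" and v: "v \<in> carrier_vec K" and G: "is_complement K v G"
    and A: "A \<in> carrier_mat K m" and t: "t \<ge> 0"
  defines "u \<equiv> (1 / vec_norm v) \<cdot>\<^sub>v v" and "B \<equiv> 1\<^sub>m K + t \<cdot>\<^sub>m (A * A\<^sup>T)"
  obtains x where "x \<in> carrier_vec K" "B *\<^sub>v x = u"
    "u \<bullet> x = Determinant.det (1\<^sub>m (K - 1) + t \<cdot>\<^sub>m (G\<^sup>T * (A * A\<^sup>T) * G)) / Determinant.det B"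
proof -
  let ?k = "K - 1"
  define U where "U = mat_of_cols K (cols G @ [u])"
  note U = is_complement_orthogonal[OF K v G, folded u_def U_def]
  have UT: "U\<^sup>T \<in> carrier_mat K K" using U(1) by simp
  have Gc: "G \<in> carrier_mat K ?k" using G by (simp add: is_complement_def)
  have Q: "A * A\<^sup>T \<in> carrier_mat K K" using A by simp
  have Bc: "B \<in> carrier_mat K K" using A by (simp add: B_def)
  \<comment> \<open>\<open>W\<close> is \<open>B\<close> written in the basis \<open>U\<close>;
    orthogonality preserves the determinant and the shape identity plus \<open>t\<close> times a
    Gram matrix.\<close>
  define W where "W = U\<^sup>T * B * U"
  have W: "W \<in> carrier_mat K K" using U(1) Bc by (simp add: W_def)
  have detW: "Determinant.det W = Determinant.det B"
  proof -
    have "Determinant.det W = Determinant.det (U\<^sup>T) * Determinant.det B * Determinant.det U"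
      unfolding W_def using UT Bc U(1) by (simp add: det_mult[of _ K])
    also have "\<dots> = Determinant.det (U\<^sup>T * U) * Determinant.det B"
      using det_mult[OF UT U(1)] by simp
    finally show ?thesis by (simp add: U(2))
  qed
  have W_alt: "W = 1\<^sub>m K + t \<cdot>\<^sub>m (U\<^sup>T * (A * A\<^sup>T) * U)"
  proof -
    have "U\<^sup>T * B = U\<^sup>T + t \<cdot>\<^sub>m (U\<^sup>T * (A * A\<^sup>T))"
      unfolding B_def using UT Q
      by (subst mult_add_distrib_mat[of _ K K _ K], auto simp: mult_smult_distrib[of _ K K _ K] simp del: transpose_carrier_mat)
    then have "W = (U\<^sup>T + t \<cdot>\<^sub>m (U\<^sup>T * (A * A\<^sup>T))) * U" by (simp add: W_def)
    also have "\<dots> = U\<^sup>T * U + (t \<cdot>\<^sub>m (U\<^sup>T * (A * A\<^sup>T))) * U"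
      using UT U(1) Q by (intro add_mult_distrib_mat[of _ K K]) auto
    also have "(t \<cdot>\<^sub>m (U\<^sup>T * (A * A\<^sup>T))) * U = t \<cdot>\<^sub>m (U\<^sup>T * (A * A\<^sup>T) * U)"
      using UT U(1) Q by (intro mult_smult_assoc_mat[of _ K K _ K]) auto
    finally show ?thesis by (simp add: U(2))
  qed
  \<comment> \<open>An entry depends only on two columns of \<open>P\<close>, so \<open>U\<close>
    and \<open>G\<close> give equal entries at all indices below \<open>K - 1\<close>.\<close>
  have entry: "(P\<^sup>T * (A * A\<^sup>T) * P) $$ (a, b) = col P a \<bullet> ((A * A\<^sup>T) *\<^sub>v col P b)"
    if P: "P \<in> carrier_mat K l" and "a < l" "b < l" for P l a b
  proof -
    have "P\<^sup>T * (A * A\<^sup>T) * P = P\<^sup>T * ((A * A\<^sup>T) * P)"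
      using P Q by (intro assoc_mult_mat[of _ l K _ K _ l]) auto
    moreover have "col ((A * A\<^sup>T) * P) b = (A * A\<^sup>T) *\<^sub>v col P b"
      using P Q that by (intro col_mult2[of _ K K _ l]) auto
    moreover have "(P\<^sup>T * ((A * A\<^sup>T) * P)) $$ (a, b) = Matrix.row (P\<^sup>T) a \<bullet> col ((A * A\<^sup>T) * P) b"
      using P Q that by (intro index_mult_mat) auto
    ultimately show ?thesis using P that by simp
  qed
  have del: "mat_delete W ?k ?k = 1\<^sub>m ?k + t \<cdot>\<^sub>m (G\<^sup>T * (A * A\<^sup>T) * G)"
  proof (rule eq_matI)
    fix a b
    assume "a < dim_row (1\<^sub>m ?k + t \<cdot>\<^sub>m (G\<^sup>T * (A * A\<^sup>T) * G))"
      and "b < dim_col (1\<^sub>m ?k + t \<cdot>\<^sub>m (G\<^sup>T * (A * A\<^sup>T) * G))"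
    then have ab: "a < ?k" "b < ?k" using Gc by auto
    have dims: "dim_row (U\<^sup>T * (A * A\<^sup>T) * U) = K" "dim_col (U\<^sup>T * (A * A\<^sup>T) * U) = K"
      "dim_row (G\<^sup>T * (A * A\<^sup>T) * G) = ?k" "dim_col (G\<^sup>T * (A * A\<^sup>T) * G) = ?k"
      using U(1) Gc by auto
    have "mat_delete W ?k ?k $$ (a, b) = W $$ (a, b)"
      using ab unfolding mat_delete_last[OF W] by simp
    also have "\<dots> = of_bool (a = b) + t * ((U\<^sup>T * (A * A\<^sup>T) * U) $$ (a, b))"
      unfolding W_alt using ab dims by (simp del: index_mult_mat)
    also have "(U\<^sup>T * (A * A\<^sup>T) * U) $$ (a, b) = (G\<^sup>T * (A * A\<^sup>T) * G) $$ (a, b)"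
      using ab entry[OF U(1), of a b] entry[OF Gc, of a b] U(4) by simp
    also have "of_bool (a = b) + t * (G\<^sup>T * (A * A\<^sup>T) * G) $$ (a, b) =
        (1\<^sub>m ?k + t \<cdot>\<^sub>m (G\<^sup>T * (A * A\<^sup>T) * G)) $$ (a, b)"
      using ab dims by (simp del: index_mult_mat)
    finally show "mat_delete W ?k ?k $$ (a, b) = (1\<^sub>m ?k + t \<cdot>\<^sub>m (G\<^sup>T * (A * A\<^sup>T) * G)) $$ (a, b)" .
  qed (use W Gc in auto)
  define d where "d = Determinant.det (1\<^sub>m ?k + t \<cdot>\<^sub>m (G\<^sup>T * (A * A\<^sup>T) * G))"
  \<comment> \<open>The last column of the adjugate is sent by \<open>W\<close> to
    \<open>det W\<close> times the last unit vector. Its last entry is the corner cofactor, with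
    sign \<open>+1\<close>, hence \<open>d\<close>.\<close>
  define a where "a = col (adj_mat W) ?k"
  have adj: "adj_mat W \<in> carrier_mat K K" by (rule adj_mat[OF W])
  have a: "a \<in> carrier_vec K" using adj K by (auto simp: a_def)
  have a_last: "a $ ?k = d"
    using W adj K by (simp add: a_def adj_mat_def cofactor_def del d_def del: One_nat_def)
  have Wa: "W *\<^sub>v a = Determinant.det B \<cdot>\<^sub>v unit_vec K ?k"
  proof -
    have "W *\<^sub>v a = col (W * adj_mat W) ?k"
      unfolding a_def using W adj K by (subst col_mult2[of _ K K _ K]) auto
    also have "\<dots> = Determinant.det B \<cdot>\<^sub>v unit_vec K ?k"
      unfolding adj_mat(2)[OF W] detW using K by (intro eq_vecI) auto
    finally show ?thesis .
  qed
  \<comment> \<open>Rotating back turns the last unit vector into \<open>u\<close>. This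
    \<open>x\<close> solves the system up to the factor \<open>det B\<close>, which is divided out
    at the end.\<close>
  define x where "x = U *\<^sub>v a"
  have x: "x \<in> carrier_vec K" using U(1) a by (simp add: x_def)
  have Ue: "U *\<^sub>v unit_vec K ?k = u"
    using U(1,5) K by (intro eq_vecI) (auto simp: col_def)
  have "B *\<^sub>v x = (U * U\<^sup>T) *\<^sub>v (B *\<^sub>v x)"
    using Bc x by (simp add: U(3))
  also have "\<dots> = U *\<^sub>v (U\<^sup>T *\<^sub>v (B *\<^sub>v x))"
    using Bc x U(1) by (intro assoc_mult_mat_vec[of _ K K _ K]) auto
  also have "U\<^sup>T *\<^sub>v (B *\<^sub>v x) = W *\<^sub>v a"
    unfolding W_def x_def using Bc a U(1) UT
    by (simp add: assoc_mult_mat_vec[of _ K K _ K])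
  also have "U *\<^sub>v (W *\<^sub>v a) = Determinant.det B \<cdot>\<^sub>v u"
    unfolding Wa using U(1) Ue by (simp add: mult_mat_vec[of _ K K])
  finally have Bx: "B *\<^sub>v x = Determinant.det B \<cdot>\<^sub>v u" .
  have "u \<bullet> x = (U *\<^sub>v unit_vec K ?k) \<bullet> (U *\<^sub>v a)"
    by (simp only: Ue x_def)
  also have "\<dots> = (U\<^sup>T *\<^sub>v (U *\<^sub>v unit_vec K ?k)) \<bullet> a"
    using U(1) a by (subst transpose_vec_mult_scalar[of _ K K]) auto
  also have "U\<^sup>T *\<^sub>v (U *\<^sub>v unit_vec K ?k) = unit_vec K ?k"
    using U(1) UT by (subst assoc_mult_mat_vec[of _ K K _ K, symmetric]) (auto simp: U(2))
  also have "unit_vec K ?k \<bullet> a = d"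
    using a K a_last by simp
  finally have ux: "u \<bullet> x = d" .
  have D: "Determinant.det B \<noteq> 0"
    unfolding B_def using det_one_plus_gram_nonzero[OF A t] .
  have uc: "u \<in> carrier_vec K" using v by (simp add: u_def)
  show thesis
  proof (rule that[of "(1 / Determinant.det B) \<cdot>\<^sub>v x"])
    show "(1 / Determinant.det B) \<cdot>\<^sub>v x \<in> carrier_vec K" using x by simp
    show "B *\<^sub>v ((1 / Determinant.det B) \<cdot>\<^sub>v x) = u"
      using D uc Bx mult_mat_vec[OF Bc x] by (simp add: smult_smult_assoc)
    show "u \<bullet> ((1 / Determinant.det B) \<cdot>\<^sub>v x) =
        Determinant.det (1\<^sub>m ?k + t \<cdot>\<^sub>m (G\<^sup>T * (A * A\<^sup>T) * G)) / Determinant.det B"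
      using uc x ux by (simp add: d_def)
  qed
qed

section \<open>Asymptotics of the quotient of determinants\<close>

lemma log_ratio_tendsto_0:
  fixes f :: "real \<Rightarrow> real"
  assumes a: "0 < a" and f: "\<forall>\<^sub>F x in at_top. a \<le> f x \<and> f x \<le> b"
  shows "((\<lambda>x. log 2 (f x) / log 2 x) \<longlongrightarrow> 0) at_top"
proof (rule tendsto_sandwich)
  show "((\<lambda>x. log 2 a / log 2 x) \<longlongrightarrow> 0) at_top" "((\<lambda>x. log 2 b / log 2 x) \<longlongrightarrow> 0) at_top"
    by real_asymp+
  show "\<forall>\<^sub>F x in at_top. log 2 a / log 2 x \<le> log 2 (f x) / log 2 x"
    "\<forall>\<^sub>F x in at_top. log 2 (f x) / log 2 x \<le> log 2 b / log 2 x"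
    using f eventually_gt_at_top[of 1] by (eventually_elim, use a in \<open>auto intro!: divide_right_mono\<close>)+
qed

text \<open>From \<open>f + 1 \<le> 2 * max 1 f\<close>, the logarithm of \<open>f + 1\<close>
  exceeds \<open>max 0 (log 2 f)\<close> by at most 1. The maximum with 0 leaves the limit alone
  because \<open>e \<ge> 0\<close>; for \<open>e = 0\<close> the function \<open>f\<close> need not
  be large.\<close>

lemma log_plus_one_ratio_tendsto:
  fixes f :: "real \<Rightarrow> real"
  assumes pos: "\<forall>\<^sub>F x in at_top. f x > 0" and e: "e \<ge> 0"
    and lim: "((\<lambda>x. log 2 (f x) / log 2 x) \<longlongrightarrow> e) at_top"
  shows "((\<lambda>x. log 2 (f x + 1) / log 2 x) \<longlongrightarrow> e) at_top"
proof (rule tendsto_sandwich)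
  let ?m = "\<lambda>x. max 0 (log 2 (f x) / log 2 x)"
  show m: "(?m \<longlongrightarrow> e) at_top"
    using tendsto_max[OF tendsto_const lim, of 0] e by simp
  have "((\<lambda>x. 1 / log 2 x) \<longlongrightarrow> 0) at_top" by real_asymp
  from tendsto_add[OF m this] show "((\<lambda>x. ?m x + 1 / log 2 x) \<longlongrightarrow> e) at_top" by simp
  show "\<forall>\<^sub>F x in at_top. ?m x \<le> log 2 (f x + 1) / log 2 x"
    using pos eventually_gt_at_top[of 1]
  proof eventually_elim
    case (elim x)
    then have "0 \<le> log 2 (f x + 1)" "log 2 (f x) \<le> log 2 (f x + 1)" by auto
    with elim show ?case by (auto intro!: divide_right_mono)
  qed
  show "\<forall>\<^sub>F x in at_top. log 2 (f x + 1) / log 2 x \<le> ?m x + 1 / log 2 x"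
    using pos eventually_gt_at_top[of 1]
  proof eventually_elim
    case (elim x)
    have "log 2 (f x + 1) \<le> log 2 (2 * max 1 (f x))"
      using elim by (intro log_mono) auto
    also have "\<dots> = 1 + max 0 (log 2 (f x))"
      using elim by (auto simp: log_mult max_def)
    finally have "log 2 (f x + 1) / log 2 x \<le> (1 + max 0 (log 2 (f x))) / log 2 x"
      using elim by (intro divide_right_mono) auto
    also have "\<dots> = ?m x + 1 / log 2 x"
      using elim by (auto simp: add_divide_distrib max_def field_simps zero_le_divide_iff divide_le_0_iff)
    finally show ?case .
  qed
qed

text \<open>The logarithm turns the weighted product into a weighted sum; the leading 1 comes from
  the factor \<open>x\<close>.\<close>

lemma log_weighted_prod_tendsto:
  fixes r :: "'b \<Rightarrow> real \<Rightarrow> real" and C :: real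
  assumes fin: "finite I" and C: "C > 0"
    and pos: "\<And>j x. j \<in> I \<Longrightarrow> x > 0 \<Longrightarrow> r j x > 0"
    and lim: "\<And>j. j \<in> I \<Longrightarrow> ((\<lambda>x. log 2 (r j x) / log 2 x) \<longlongrightarrow> L j) at_top"
  shows "((\<lambda>x. log 2 (C * x * (\<Prod>j\<in>I. r j x powr w j)) / log 2 x) \<longlongrightarrow> 1 + (\<Sum>j\<in>I. w j * L j)) at_top"
proof -
  have "((\<lambda>x. log 2 C / log 2 x + 1 + (\<Sum>j\<in>I. w j * (log 2 (r j x) / log 2 x))) \<longlongrightarrow>
      0 + 1 + (\<Sum>j\<in>I. w j * L j)) at_top"
    by (intro tendsto_intros lim) real_asymp
  moreover have "\<forall>\<^sub>F x in at_top. log 2 C / log 2 x + 1 + (\<Sum>j\<in>I. w j * (log 2 (r j x) / log 2 x)) =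
      log 2 (C * x * (\<Prod>j\<in>I. r j x powr w j)) / log 2 x"
    using eventually_gt_at_top[of 1]
  proof eventually_elim
    case (elim x)
    have ne: "r j x \<noteq> 0" if "j \<in> I" for j using pos[OF that, of x] elim by simp
    have "log 2 (\<Prod>j\<in>I. r j x powr w j) = (\<Sum>j\<in>I. w j * log 2 (r j x))"
      using fin ne by (simp add: log_def ln_prod ln_powr sum_divide_distrib)
    moreover have "(\<Prod>j\<in>I. r j x powr w j) \<noteq> 0"
      using fin ne by simp
    ultimately have "log 2 (C * x * (\<Prod>j\<in>I. r j x powr w j)) =
        log 2 C + log 2 x + (\<Sum>j\<in>I. w j * log 2 (r j x))"
      using C elim by (simp add: log_mult)
    moreover have "0 < log 2 x" using elim by simp
    ultimately show ?case
      by (simp add: add_divide_distrib sum_divide_distrib)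
  qed
  ultimately show ?thesis by (auto intro: Lim_transform_eventually)
qed

section \<open>Reduction from complex to real matrices\<close>

lemma mat_adjoint_carrier:
  "A \<in> carrier_mat k l \<Longrightarrow> mat_adjoint A \<in> carrier_mat l k"
  by (auto simp: mat_adjoint_def mat_of_rows_def)

lemma map_of_real_adjoint:
  "mat_adjoint (map_mat complex_of_real R) = map_mat complex_of_real R\<^sup>T"
  by (rule eq_matI) (auto simp: mat_adjoint_def mat_of_rows_def)

text \<open>The phases of the gains cancel against their conjugates, so only the moduli
  survive.\<close>

lemma mat_diag_gram:
  "mat_diag m g * mat_adjoint (mat_diag m g) =
     map_mat complex_of_real (mat_diag m (\<lambda>l. cmod (g l)) * (mat_diag m (\<lambda>l. cmod (g l)))\<^sup>T)"
proof -
  have "mat_adjoint (mat_diag m g) = mat_diag m (\<lambda>l. cnj (g l))"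
    by (rule eq_matI) (auto simp: mat_adjoint_def mat_of_rows_def mat_diag_def)
  moreover have "(mat_diag m (\<lambda>l. cmod (g l)))\<^sup>T = mat_diag m (\<lambda>l. cmod (g l))"
    by (rule eq_matI) (auto simp: mat_diag_def)
  ultimately show ?thesis
    by simp (rule eq_matI, auto simp: mat_diag_def power2_eq_square complex_norm_square[symmetric])
qed

definition scaled_mat :: "nat \<Rightarrow> int mat \<Rightarrow> (nat \<Rightarrow> complex) \<Rightarrow> real mat" where
  "scaled_mat m S g = map_mat real_of_int S * mat_diag m (\<lambda>l. cmod (g l))"

lemma scaled_mat_carrier: "S \<in> carrier_mat K m \<Longrightarrow> scaled_mat m S g \<in> carrier_mat K m"
  by (auto simp: scaled_mat_def mat_diag_def)

text \<open>Regrouping puts the gain matrix next to its adjoint, where \<open>mat_diag_gram\<close>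
  applies; the real product is then regrouped into a Gram matrix.\<close>

lemma covariance_real:
  assumes S: "S \<in> carrier_mat K m"
  shows "cmplx_mat S * mat_diag m g * mat_adjoint (mat_diag m g) * mat_adjoint (cmplx_mat S) =
    map_mat complex_of_real (scaled_mat m S g * (scaled_mat m S g)\<^sup>T)"
proof -
  let ?R = "map_mat real_of_int S" and ?D = "mat_diag m (\<lambda>l. cmod (g l))"
  let ?C = "map_mat complex_of_real"
  have R: "?R \<in> carrier_mat K m" using S by simp
  have D: "?D \<in> carrier_mat m m" by simp
  have DD: "?D * ?D\<^sup>T \<in> carrier_mat m m" using D by (metis mult_carrier_mat transpose_carrier_mat)
  have X: "mat_diag m g \<in> carrier_mat m m" by simp
  have X': "mat_adjoint (mat_diag m g) \<in> carrier_mat m m"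
    using mat_adjoint_carrier[OF X] by simp
  have SR: "cmplx_mat S = ?C ?R" by (rule eq_matI) auto
  have "cmplx_mat S * mat_diag m g * mat_adjoint (mat_diag m g) =
      ?C ?R * (mat_diag m g * mat_adjoint (mat_diag m g))"
    unfolding SR using R X X' by (intro assoc_mult_mat[of _ K m _ m _ m]) auto
  also have "\<dots> = ?C (?R * (?D * ?D\<^sup>T))"
    unfolding mat_diag_gram by (rule of_real_hom.mat_hom_mult[symmetric, OF R DD])
  also have "?R * (?D * ?D\<^sup>T) = ?R * ?D * ?D\<^sup>T"
    using R D by (intro assoc_mult_mat[symmetric, of _ K m _ m _ m]) auto
  finally have "cmplx_mat S * mat_diag m g * mat_adjoint (mat_diag m g) * mat_adjoint (cmplx_mat S) =
      ?C (?R * ?D * ?D\<^sup>T) * ?C (?R\<^sup>T)"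
    unfolding SR map_of_real_adjoint by simp
  also have "\<dots> = ?C (?R * ?D * ?D\<^sup>T * ?R\<^sup>T)"
    using R D by (intro of_real_hom.mat_hom_mult[symmetric, of _ K m _ K] mult_carrier_mat[of _ K m]) auto
  also have "?R * ?D * ?D\<^sup>T * ?R\<^sup>T = (?R * ?D) * (?D\<^sup>T * ?R\<^sup>T)"
    using R D by (intro assoc_mult_mat[of _ K m _ m _ K] mult_carrier_mat[of _ K m]) auto
  also have "?D\<^sup>T * ?R\<^sup>T = (?R * ?D)\<^sup>T"
    using R D by (intro transpose_mult[symmetric, of _ K m _ m]) auto
  finally show ?thesis unfolding scaled_mat_def .
qed

text \<open>The determinant commutes with the embedding of the reals, so taking the real part loses
  nothing.\<close>

lemma det_one_plus_complex:
  assumes Q: "Q \<in> carrier_mat k k"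
  shows "Re (Determinant.det (1\<^sub>m k + complex_of_real c \<cdot>\<^sub>m map_mat complex_of_real Q)) =
    Determinant.det (1\<^sub>m k + c \<cdot>\<^sub>m Q)"
proof -
  have "1\<^sub>m k + complex_of_real c \<cdot>\<^sub>m map_mat complex_of_real Q =
      map_mat complex_of_real (1\<^sub>m k + c \<cdot>\<^sub>m Q)"
    by (rule eq_matI) (use Q in auto)
  then show ?thesis by (simp add: of_real_hom.hom_det)
qed

lemma det_full_real:
  assumes S: "S \<in> carrier_mat K m"
  shows "det_full K c S (mat_diag m g) =
    Determinant.det (1\<^sub>m K + c \<cdot>\<^sub>m (scaled_mat m S g * (scaled_mat m S g)\<^sup>T))"
  unfolding det_full_def covariance_real[OF S]
  by (rule det_one_plus_complex) (use scaled_mat_carrier[OF S, of g] in auto)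

lemma det_proj_real:
  assumes S: "S \<in> carrier_mat K m" and G: "G \<in> carrier_mat K (K - 1)"
  shows "det_proj K c G S (mat_diag m g) =
    Determinant.det (1\<^sub>m (K - 1) + c \<cdot>\<^sub>m (G\<^sup>T * (scaled_mat m S g * (scaled_mat m S g)\<^sup>T) * G))"
proof -
  let ?C = "map_mat complex_of_real" and ?X = "mat_diag m g"
  let ?Q = "scaled_mat m S g * (scaled_mat m S g)\<^sup>T"
  have Q: "?Q \<in> carrier_mat K K" using scaled_mat_carrier[OF S, of g] by auto
  have GT: "?C G\<^sup>T \<in> carrier_mat (K - 1) K" using G by simp
  have Sc: "cmplx_mat S \<in> carrier_mat K m" using S by simp
  have S': "mat_adjoint (cmplx_mat S) \<in> carrier_mat m K" using mat_adjoint_carrier[OF Sc] .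
  have X: "?X \<in> carrier_mat m m" by simp
  have X': "mat_adjoint ?X \<in> carrier_mat m m" using mat_adjoint_carrier[OF X] .
  note carr = mult_carrier_mat[OF Sc X] mult_carrier_mat[OF mult_carrier_mat[OF Sc X] X']
  have "mat_adjoint (?C G) * cmplx_mat S * ?X * mat_adjoint ?X * mat_adjoint (cmplx_mat S) * ?C G =
      ?C G\<^sup>T * (cmplx_mat S * ?X * mat_adjoint ?X * mat_adjoint (cmplx_mat S)) * ?C G"
    unfolding map_of_real_adjoint
    by (simp only: assoc_mult_mat[OF GT Sc X] assoc_mult_mat[OF GT carr(1) X'] assoc_mult_mat[OF GT carr(2) S'])
  also have "\<dots> = ?C (G\<^sup>T * ?Q) * ?C G"
    unfolding covariance_real[OF S] using G Q
    by (subst of_real_hom.mat_hom_mult[of _ "K - 1" K _ K]) auto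
  also have "\<dots> = ?C (G\<^sup>T * ?Q * G)"
    using G Q by (intro of_real_hom.mat_hom_mult[symmetric, of _ "K - 1" K _ "K - 1"]) auto
  finally show ?thesis
    unfolding det_proj_def using G Q by (simp add: det_one_plus_complex)
qed

section \<open>Growth of the determinant quotient\<close>

text \<open>One factor of the product in \<open>varrho\<close> before it is raised to its power;
  \<open>c\<close> stands for \<open>\<beta>\<^sup>2 * \<gamma>\<close>.\<close>

definition det_ratio :: "nat \<Rightarrow> real mat \<Rightarrow> int mat \<Rightarrow> complex mat \<Rightarrow> real \<Rightarrow> real" where
  "det_ratio K G S X c = det_proj K c G S X / det_full K c S X"

context
  fixes K m :: nat and v :: "real vec" and G :: "real mat" and S :: "int mat" and g :: "nat \<Rightarrow> complex"
  assumes K: "K \<ge> 1" and v: "v \<in> carrier_vec K" "v \<noteq> 0\<^sub>v K" and G: "is_complement K v G"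
    and S: "S \<in> carrier_mat K m" and g: "\<And>l. l < m \<Longrightarrow> g l \<noteq> 0"
begin

abbreviation (input) "scaled \<equiv> scaled_mat m S g"
abbreviation (input) "dir_v \<equiv> (1 / vec_norm v) \<cdot>\<^sub>v v"

lemma normalized_unit: "dir_v \<bullet> dir_v = 1"
proof -
  have "v \<bullet> v > 0" using scalar_prod_self_pos[OF v] .
  then show ?thesis using v(1) by (simp add: vec_norm_def)
qed

lemma det_ratio_eq_resolvent:
  assumes c: "c > 0"
  obtains x where "x \<in> carrier_vec K" "(1\<^sub>m K + c \<cdot>\<^sub>m (scaled * scaled\<^sup>T)) *\<^sub>v x = dir_v"
    "dir_v \<bullet> x = det_ratio K G S (mat_diag m g) c"
proof -
  have Gc: "G \<in> carrier_mat K (K - 1)" using G by (simp add: is_complement_def)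
  show thesis
    using cramer_resolvent[OF K v(1) G scaled_mat_carrier[OF S, of g], of c] c that
    unfolding det_ratio_def det_full_real[OF S] det_proj_real[OF S Gc] by auto
qed

lemma det_ratio_pos:
  assumes c: "c > 0"
  shows "det_ratio K G S (mat_diag m g) c > 0"
proof -
  obtain x where x: "x \<in> carrier_vec K" "(1\<^sub>m K + c \<cdot>\<^sub>m (scaled * scaled\<^sup>T)) *\<^sub>v x = dir_v"
    "dir_v \<bullet> x = det_ratio K G S (mat_diag m g) c"
    using det_ratio_eq_resolvent[OF c] .
  have "1 / (1 + c * ((scaled\<^sup>T *\<^sub>v dir_v) \<bullet> (scaled\<^sup>T *\<^sub>v dir_v))) \<le> dir_v \<bullet> x"
    using v by (intro resolvent_lower[OF scaled_mat_carrier[OF S] c _ normalized_unit x(1,2)]) simp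
  moreover have "0 < 1 / (1 + c * ((scaled\<^sup>T *\<^sub>v dir_v) \<bullet> (scaled\<^sup>T *\<^sub>v dir_v)))"
    using c scalar_prod_self_nonneg by (intro divide_pos_pos add_pos_nonneg mult_nonneg_nonneg) auto
  ultimately show ?thesis unfolding x(3) by (rule less_le_trans[rotated])
qed

text \<open>A vector orthogonal to the columns of \<open>S\<close> is orthogonal to their multiples,
  so the witness for \<open>S\<close> also serves the scaled matrix. It gives a lower bound uniform
  in \<open>c\<close>.\<close>

lemma det_ratio_bounds_outside:
  assumes "v \<notin> csp K S"
  shows "\<exists>a>0. \<forall>c>0. a \<le> det_ratio K G S (mat_diag m g) c \<and> det_ratio K G S (mat_diag m g) c \<le> 1"
proof -
  let ?R = "map_mat real_of_int S" and ?D = "mat_diag m (\<lambda>l. cmod (g l))"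
  have R: "?R \<in> carrier_mat K m" using S by simp
  obtain z where z: "z \<in> carrier_vec K" "?R\<^sup>T *\<^sub>v z = 0\<^sub>v m" "z \<bullet> v \<noteq> 0"
    using outside_col_space_witness[OF R v(1)] assms unfolding csp_def by blast
  have D: "?D \<in> carrier_mat m m" by simp
  have DT: "?D\<^sup>T \<in> carrier_mat m m" by simp
  have RT: "?R\<^sup>T \<in> carrier_mat m K" using R by simp
  have Az: "scaled\<^sup>T *\<^sub>v z = 0\<^sub>v m"
    unfolding scaled_mat_def transpose_mult[OF R D] assoc_mult_mat_vec[OF DT RT z(1)] z(2)
    by (intro eq_vecI) (auto simp: mat_diag_def)
  have nv: "vec_norm v > 0" using scalar_prod_self_pos[OF v] by (simp add: vec_norm_def)
  have zz: "z \<bullet> z > 0"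
  proof (rule scalar_prod_self_pos[OF z(1)])
    show "z \<noteq> 0\<^sub>v K" using z(3) v(1) by auto
  qed
  have zu: "z \<bullet> dir_v \<noteq> 0" using z(1,3) v(1) nv by simp
  show ?thesis
  proof (rule exI[of _ "(z \<bullet> dir_v)\<^sup>2 / (z \<bullet> z)"], safe)
    show "(z \<bullet> dir_v)\<^sup>2 / (z \<bullet> z) > 0" using zz zu by simp
    fix c :: real assume c: "c > 0"
    obtain x where x: "x \<in> carrier_vec K" "(1\<^sub>m K + c \<cdot>\<^sub>m (scaled * scaled\<^sup>T)) *\<^sub>v x = dir_v"
      "dir_v \<bullet> x = det_ratio K G S (mat_diag m g) c"
      using det_ratio_eq_resolvent[OF c] .
    have u: "dir_v \<in> carrier_vec K" using v by simp
    note res = scaled_mat_carrier[OF S] c u normalized_unit x(1,2)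
    show "(z \<bullet> dir_v)\<^sup>2 / (z \<bullet> z) \<le> det_ratio K G S (mat_diag m g) c"
      using resolvent_lower_outside[OF res z(1) Az] zz
      unfolding x(3) by (simp add: pos_divide_le_eq mult.commute)
    show "det_ratio K G S (mat_diag m g) c \<le> 1"
      using resolvent_upper[OF res] unfolding x(3) .
  qed
qed

text \<open>The quotient is of exact order \<open>1 / c\<close>: a preimage of the direction of
  \<open>v\<close> under the scaled matrix bounds it from above, the general resolvent bound from
  below.\<close>

lemma det_ratio_bounds_inside:
  assumes "v \<in> csp K S"
  shows "\<exists>a>0. \<exists>b. \<forall>c\<ge>1. a \<le> c * det_ratio K G S (mat_diag m g) c \<and> c * det_ratio K G S (mat_diag m g) c \<le> b"
proof -
  let ?R = "map_mat real_of_int S" and ?D = "mat_diag m (\<lambda>l. cmod (g l))"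
  have R: "?R \<in> carrier_mat K m" using S by simp
  have D: "?D \<in> carrier_mat m m" by simp
  obtain y where y: "y \<in> carrier_vec m" "?R *\<^sub>v y = v"
    using assms R unfolding csp_def vec_space.col_space_eq[OF R] by auto
  \<comment> \<open>Dividing by the moduli, which are nonzero, undoes the column scaling.\<close>
  define y' where "y' = Matrix.vec m (\<lambda>l. y $ l / cmod (g l))"
  have y': "y' \<in> carrier_vec m" by (simp add: y'_def)
  have "?D *\<^sub>v y' = y"
  proof (rule eq_vecI)
    fix l assume l: "l < dim_vec y"
    then have lm: "l < m" using y by simp
    have "(?D *\<^sub>v y') $ l = (\<Sum>k = 0..<m. (if l = k then cmod (g k) else 0) * (y $ k / cmod (g k)))"
      using lm by (simp add: mat_diag_def scalar_prod_def y'_def)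
    also have "\<dots> = (\<Sum>k = 0..<m. if l = k then y $ k else 0)"
      using g by (intro sum.cong) auto
    finally show "(?D *\<^sub>v y') $ l = y $ l" using lm by simp
  qed (use y in \<open>simp add: mat_diag_def\<close>)
  then have "scaled *\<^sub>v y' = v"
    unfolding scaled_mat_def assoc_mult_mat_vec[OF R D y'] by (simp add: y(2))
  then have Ay: "scaled *\<^sub>v ((1 / vec_norm v) \<cdot>\<^sub>v y') = dir_v"
    using mult_mat_vec[OF scaled_mat_carrier[OF S] y'] by simp
  have y'': "(1 / vec_norm v) \<cdot>\<^sub>v y' \<in> carrier_vec m" using y' by simp
  define q where "q = (scaled\<^sup>T *\<^sub>v dir_v) \<bullet> (scaled\<^sup>T *\<^sub>v dir_v)"
  have q: "q \<ge> 0" unfolding q_def by (rule scalar_prod_self_nonneg)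
  show ?thesis
  proof (rule exI[of _ "1 / (1 + q)"], intro conjI exI allI impI)
    show "1 / (1 + q) > 0" using q by simp
    fix c :: real assume c1: "c \<ge> 1"
    then have c: "c > 0" by simp
    obtain x where x: "x \<in> carrier_vec K" "(1\<^sub>m K + c \<cdot>\<^sub>m (scaled * scaled\<^sup>T)) *\<^sub>v x = dir_v"
      "dir_v \<bullet> x = det_ratio K G S (mat_diag m g) c"
      using det_ratio_eq_resolvent[OF c] .
    have u: "dir_v \<in> carrier_vec K" using v by simp
    note res = scaled_mat_carrier[OF S] c u normalized_unit x(1,2)
    \<comment> \<open>Since \<open>c \<ge> 1\<close>, the denominator \<open>1 + c * q\<close> is at
      most \<open>c + c * q\<close>, which makes the lower bound independent of
      \<open>c\<close>.\<close>
    have "c + c * q = c * (1 + q)" by (simp add: distrib_left)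
    then have "1 / (1 + q) = c * (1 / (c + c * q))"
      using c by simp
    also have "\<dots> \<le> c * (1 / (1 + c * q))"
      using c1 q by (intro mult_left_mono divide_left_mono mult_pos_pos add_pos_nonneg) auto
    also have "\<dots> \<le> c * det_ratio K G S (mat_diag m g) c"
      using resolvent_lower[OF res] c unfolding x(3) q_def by (intro mult_left_mono) auto
    finally show "1 / (1 + q) \<le> c * det_ratio K G S (mat_diag m g) c" .
    show "c * det_ratio K G S (mat_diag m g) c \<le>
        ((1 / vec_norm v) \<cdot>\<^sub>v y') \<bullet> ((1 / vec_norm v) \<cdot>\<^sub>v y')"
      using resolvent_upper_inside[OF res y'' Ay] unfolding x(3) by blast
  qed
qed

text \<open>Outside the column space the quotient stays between positive constants and its logarithm
  is negligible. Inside, this holds for the quotient times \<open>b * \<gamma>\<close>, and removing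
  that factor contributes -1.\<close>

lemma log_det_ratio_tendsto:
  assumes b: "b > 0"
  shows "((\<lambda>\<gamma>. log 2 (det_ratio K G S (mat_diag m g) (b * \<gamma>)) / log 2 \<gamma>) \<longlongrightarrow>
    - of_bool (v \<in> csp K S)) at_top"
proof -
  let ?r = "\<lambda>\<gamma>. det_ratio K G S (mat_diag m g) (b * \<gamma>)"
  show ?thesis
  proof (cases "v \<in> csp K S")
    case False
    obtain a where a: "a > 0" "\<forall>c>0. a \<le> det_ratio K G S (mat_diag m g) c \<and> det_ratio K G S (mat_diag m g) c \<le> 1"
      using det_ratio_bounds_outside[OF False] by blast
    have "\<forall>\<^sub>F \<gamma> in at_top. a \<le> ?r \<gamma> \<and> ?r \<gamma> \<le> 1"
      using eventually_gt_at_top[of 0] by eventually_elim (use a b in auto)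
    from log_ratio_tendsto_0[OF a(1) this] False show ?thesis by simp
  next
    case True
    obtain a d where a: "a > 0"
      "\<forall>c\<ge>1. a \<le> c * det_ratio K G S (mat_diag m g) c \<and> c * det_ratio K G S (mat_diag m g) c \<le> d"
      using det_ratio_bounds_inside[OF True] by blast
    have "\<forall>\<^sub>F \<gamma> in at_top. a \<le> (b * \<gamma>) * ?r \<gamma> \<and> (b * \<gamma>) * ?r \<gamma> \<le> d"
      using eventually_ge_at_top[of "1 / b"]
      by eventually_elim (use a(2) b in \<open>auto simp: pos_divide_le_eq mult.commute\<close>)
    from log_ratio_tendsto_0[OF a(1) this]
    have lim: "((\<lambda>\<gamma>. log 2 ((b * \<gamma>) * ?r \<gamma>) / log 2 \<gamma>) \<longlongrightarrow> 0) at_top" .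
    have "((\<lambda>\<gamma>. log 2 b / log 2 \<gamma>) \<longlongrightarrow> 0) at_top" by real_asymp
    from tendsto_diff[OF tendsto_diff[OF lim this] tendsto_const[of 1]]
    have "((\<lambda>\<gamma>. log 2 ((b * \<gamma>) * ?r \<gamma>) / log 2 \<gamma> - log 2 b / log 2 \<gamma> - 1) \<longlongrightarrow> - 1) at_top"
      by simp
    moreover have "\<forall>\<^sub>F \<gamma> in at_top. log 2 ((b * \<gamma>) * ?r \<gamma>) / log 2 \<gamma> - log 2 b / log 2 \<gamma> - 1 =
        log 2 (?r \<gamma>) / log 2 \<gamma>"
      using eventually_gt_at_top[of 1]
    proof eventually_elim
      case (elim \<gamma>)
      then have "?r \<gamma> > 0" using b by (intro det_ratio_pos) simp
      then have "log 2 ((b * \<gamma>) * ?r \<gamma>) = log 2 b + log 2 \<gamma> + log 2 (?r \<gamma>)"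
        using b elim by (simp add: log_mult)
      moreover have "0 < log 2 \<gamma>" using elim by simp
      ultimately show ?case by (simp add: field_simps)
    qed
    ultimately show ?thesis using True by (auto intro: Lim_transform_eventually)
  qed
qed

end

section \<open>Finitely supported random objects and independent codes\<close>

context prob_space
begin

lemma supp_subset:
  assumes "AE w in M. X w \<in> F"
  shows "supp M X \<subseteq> F"
proof
  fix x assume "x \<in> supp M X"
  then have pos: "prob {w \<in> space M. X w = x} > 0" by (simp add: supp_def)
  show "x \<in> F"
  proof (rule ccontr)
    assume "x \<notin> F"
    with assms have "AE w in M. X w \<noteq> x" by (auto elim: eventually_mono)
    \<comment> \<open>\<open>measure\<close> is 0 on sets that are not events, so a positive value
      certifies measurability.\<close>
    moreover have "{w \<in> space M. X w = x} \<in> events"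
      using pos by (metis measure_notin_sets less_irrefl)
    ultimately show False using pos prob_eq_0[of "{w \<in> space M. X w = x}"]
      by (auto elim: eventually_mono)
  qed
qed

text \<open>Only the finitely many values of \<open>F\<close> outside the support have to be
  excluded, each at the cost of a null set.\<close>

lemma AE_in_supp:
  assumes "finite F" and "AE w in M. X w \<in> F"
    and meas: "\<And>x. {w \<in> space M. X w = x} \<in> events"
  shows "AE w in M. X w \<in> supp M X"
proof -
  have "AE w in M. X w \<noteq> x" if "x \<notin> supp M X" for x
  proof -
    have "prob {w \<in> space M. X w = x} = 0"
      using that measure_nonneg[of M "{w \<in> space M. X w = x}"] by (simp add: supp_def)
    then show ?thesis
      using prob_eq_0[OF meas, of x] by auto
  qed
  then have "AE w in M. \<forall>x\<in>F - supp M X. X w \<noteq> x"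
    using assms(1) by (intro AE_finite_allI) auto
  with assms(2) show ?thesis by eventually_elim auto
qed

lemma prob_by_supp:
  assumes fin: "finite (supp M X)" and ae: "AE w in M. X w \<in> supp M X"
    and E: "\<And>x. {w \<in> space M. X w = x \<and> P w} \<in> events" and EP: "{w \<in> space M. P w} \<in> events"
  shows "prob {w \<in> space M. P w} = (\<Sum>x\<in>supp M X. prob {w \<in> space M. X w = x \<and> P w})"
proof -
  have "prob {w \<in> space M. P w} = prob (\<Union>x\<in>supp M X. {w \<in> space M. X w = x \<and> P w})"
    using ae fin E EP by (intro finite_measure_eq_AE) auto
  also have "\<dots> = (\<Sum>x\<in>supp M X. prob {w \<in> space M. X w = x \<and> P w})"
    using fin E by (intro finite_measure_finite_Union) (auto simp: disjoint_family_on_def)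
  finally show ?thesis .
qed

lemma sum_supp_eq_1:
  assumes fin: "finite (supp M X)" and ae: "AE w in M. X w \<in> supp M X"
    and meas: "\<And>x. {w \<in> space M. X w = x} \<in> events"
  shows "(\<Sum>x\<in>supp M X. prob {w \<in> space M. X w = x}) = 1"
  using prob_by_supp[OF fin ae, of "\<lambda>_. True"] meas by (simp add: prob_space)

end

section \<open>Signature codes and the random code matrix\<close>

lemma finite_set_code_pmf:
  assumes "finite (set_pmf p)"
  shows "finite (set_pmf (code_pmf K p \<epsilon>))"
  unfolding code_pmf_def using assms
  by (auto simp: set_Pi_pmf intro!: finite_imageI finite_cartesian_product finite_PiE_dflt)

lemma set_code_pmf_carrier: "set_pmf (code_pmf K p \<epsilon>) \<subseteq> carrier_vec K"
  by (auto simp: code_pmf_def)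

lemma others_props:
  assumes "1 \<le> i" "i \<le> n"
  shows "set (others n i) = {1..n} - {i}" "distinct (others n i)" "length (others n i) = n - 1"
proof -
  show 1: "set (others n i) = {1..n} - {i}" by (auto simp: others_def)
  show 2: "distinct (others n i)" by (simp add: others_def)
  have "card ({1..n} - {i}) = n - 1" using assms by (subst card_Diff_singleton) auto
  with distinct_card[OF 2] 1 show "length (others n i) = n - 1" by simp
qed

text \<open>This splits the event that the matrix equals \<open>S\<close> into conditions on single
  codes, the form required for measurability and independence.\<close>

lemma code_mat_eq_iff:
  assumes "1 \<le> i" "i \<le> n"
  shows "code_mat K n i s w = S \<longleftrightarrow> S \<in> carrier_mat K (n - 1) \<and>
    (\<forall>l<n - 1. \<forall>k<K. s (others n i ! l) w $ k = S $$ (k, l))"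
  using others_props(3)[OF assms]
  by (auto simp: code_mat_def mat_of_cols_def intro!: eq_matI)

text \<open>The law \<open>\<mu>\<close> is kept abstract; the final theorem instantiates it with
  \<open>code_pmf K p \<epsilon>\<close>.\<close>

locale codes = prob_space +
  fixes K n i :: nat and s :: "nat \<Rightarrow> 'a \<Rightarrow> int vec" and \<mu> :: "int vec pmf"
  assumes i: "1 \<le> i" "i \<le> n" and n: "n \<ge> 2"
    and indep: "indep_vars (\<lambda>_. count_space UNIV) s {1..n}"
    and law: "\<And>j. j \<in> {1..n} \<Longrightarrow> distr M (count_space UNIV) (s j) = measure_pmf \<mu>"
    and fin: "finite (set_pmf \<mu>)" and car: "set_pmf \<mu> \<subseteq> carrier_vec K"
begin

lemma s_measurable: "j \<in> {1..n} \<Longrightarrow> s j \<in> measurable M (count_space UNIV)"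
  using indep by (simp add: indep_vars_def)

lemma s_event: "j \<in> {1..n} \<Longrightarrow> {w \<in> space M. P (s j w)} \<in> events"
  using measurable_sets[OF s_measurable, of j "{x. P x}"] by (simp add: vimage_def Int_def conj_commute)

lemma AE_s: "j \<in> {1..n} \<Longrightarrow> AE w in M. s j w \<in> set_pmf \<mu>"
proof -
  assume j: "j \<in> {1..n}"
  have "AE x in distr M (count_space UNIV) (s j). x \<in> set_pmf \<mu>"
    unfolding law[OF j] by (rule AE_measure_pmf)
  then show ?thesis by (subst (asm) AE_distr_iff[OF s_measurable[OF j]]) auto
qed

lemma others_le: "l < n - 1 \<Longrightarrow> others n i ! l \<in> {1..n} - {i}"
  using others_props[OF i] nth_mem by metis

lemma i_range: "i \<in> {1..n}" using i by simp

abbreviation "Smat \<equiv> code_mat K n i s"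

lemma Smat_event: "{w \<in> space M. Smat w = S} \<in> events"
proof (cases "S \<in> carrier_mat K (n - 1)")
  case True
  let ?Q = "\<lambda>l x. \<forall>k<K. x $ k = S $$ (k, l)"
  have "{w \<in> space M. Smat w = S} = {w \<in> space M. \<forall>l\<in>{..<n - 1}. ?Q l (s (others n i ! l) w)}"
    using True unfolding code_mat_eq_iff[OF i] by blast
  also have "\<dots> \<in> events"
    using others_le by (intro sets.sets_Collect_finite_All s_event) auto
  finally show ?thesis .
next
  case False
  then have "{w \<in> space M. Smat w = S} = {}"
    unfolding code_mat_eq_iff[OF i] by blast
  then show ?thesis by (simp only: sets.empty_sets)
qed

lemma Smat_carrier: "Smat w \<in> carrier_mat K (n - 1)"
  using code_mat_eq_iff[OF i, of K s w "Smat w"] by simp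

lemma AE_Smat: "AE w in M. Smat w \<in> mat_of_cols K ` {xs. set xs \<subseteq> set_pmf \<mu> \<and> length xs = n - 1}"
proof -
  have "AE w in M. \<forall>j\<in>{1..n}. s j w \<in> set_pmf \<mu>"
    by (intro AE_finite_allI AE_s) auto
  then show ?thesis
  proof eventually_elim
    case (elim w)
    then show ?case using others_props[OF i] unfolding code_mat_def by (intro imageI) auto
  qed
qed

lemma finite_Smat: "finite (mat_of_cols K ` {xs. set xs \<subseteq> set_pmf \<mu> \<and> length xs = n - 1})"
  using fin by (intro finite_imageI finite_lists_length_eq)

lemmas AE_Smat_supp = AE_in_supp[OF finite_Smat AE_Smat Smat_event]
lemmas AE_s_supp = AE_in_supp[OF fin AE_s[OF i_range] s_event[OF i_range]]

lemma finite_supp_Smat: "finite (supp M Smat)"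
  using supp_subset[OF AE_Smat] finite_Smat finite_subset by blast

lemma finite_supp_s: "finite (supp M (s i))"
  using supp_subset[OF AE_s[OF i_range]] fin finite_subset by blast

lemma supp_s_carrier: "v \<in> supp M (s i) \<Longrightarrow> v \<in> carrier_vec K"
  using supp_subset[OF AE_s[OF i_range]] car by blast

lemma supp_Smat_carrier: "S \<in> supp M Smat \<Longrightarrow> S \<in> carrier_mat K (n - 1)"
  using supp_subset[of Smat "carrier_mat K (n - 1)"] Smat_carrier by auto

text \<open>Both the joint event and the matrix event are intersections of conditions on single
  codes, over all users and over all users but \<open>i\<close>. Independence factors both, and the
  products differ by the factor of user \<open>i\<close>.\<close>

lemma joint_prob:
  "prob {w \<in> space M. s i w = v \<and> Smat w = S} =
     prob {w \<in> space M. s i w = v} * prob {w \<in> space M. Smat w = S}"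
proof (cases "S \<in> carrier_mat K (n - 1)")
  case False
  then have "Smat w \<noteq> S" for w using Smat_carrier by metis
  then show ?thesis by simp
next
  case True
  define J where "J = {1..n} - {i}"
  \<comment> \<open>The condition on code \<open>j\<close> quantifies over the positions
    \<open>l\<close> holding \<open>j\<close>, which avoids inverting the enumeration
    \<open>others\<close>.\<close>
  define B where "B j = (if j = i then {v} else
      {x. \<forall>l<n - 1. others n i ! l = j \<longrightarrow> (\<forall>k<K. x $ k = S $$ (k, l))})" for j
  \<comment> \<open>An intersection over no indices would be the whole type instead of
    \<open>space M\<close>; \<open>n \<ge> 2\<close> rules this out.\<close>
  have "J \<noteq> {}"
  proof (cases "i = 1")
    case True
    then have "2 \<in> J" using n by (simp add: J_def)
    then show ?thesis by blast
  next
    case False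
    then have "1 \<in> J" using n by (simp add: J_def)
    then show ?thesis by blast
  qed
  then have J: "J \<noteq> {}" "finite J" "i \<notin> J" "insert i J = {1..n}"
    using i_range by (auto simp: J_def)
  let ?E = "\<lambda>j. s j -` B j \<inter> space M"
  have SE: "{w \<in> space M. Smat w = S} = (\<Inter>j\<in>J. ?E j)"
  proof (intro subset_antisym subsetI)
    fix w assume "w \<in> {w \<in> space M. Smat w = S}"
    then have w: "w \<in> space M" "\<forall>l<n - 1. \<forall>k<K. s (others n i ! l) w $ k = S $$ (k, l)"
      using code_mat_eq_iff[OF i, of K s w S] by simp_all
    then show "w \<in> (\<Inter>j\<in>J. ?E j)" using J by (auto simp: B_def)
  next
    fix w assume w: "w \<in> (\<Inter>j\<in>J. ?E j)"
    have "s (others n i ! l) w $ k = S $$ (k, l)" if "l < n - 1" "k < K" for l k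
    proof -
      have "others n i ! l \<in> J" using others_le[OF that(1)] by (simp add: J_def)
      with w have "s (others n i ! l) w \<in> B (others n i ! l)" by blast
      then show ?thesis using \<open>others n i ! l \<in> J\<close> J(3) that by (auto simp: B_def split: if_splits)
    qed
    moreover have "w \<in> space M" using w J(1) by auto
    ultimately show "w \<in> {w \<in> space M. Smat w = S}"
      using code_mat_eq_iff[OF i, of K s w S] True by simp
  qed
  have vE: "{w \<in> space M. s i w = v} = ?E i" by (auto simp: B_def)
  have "{w \<in> space M. s i w = v \<and> Smat w = S} = {w \<in> space M. s i w = v} \<inter> {w \<in> space M. Smat w = S}"
    by auto
  also have "\<dots> = (\<Inter>j\<in>insert i J. ?E j)"
    unfolding SE vE by simp
  finally have "prob {w \<in> space M. s i w = v \<and> Smat w = S} = prob (\<Inter>j\<in>insert i J. ?E j)" by simp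
  also have "\<dots> = (\<Prod>j\<in>insert i J. prob (?E j))"
    using J by (intro indep_varsD[OF indep]) auto
  also have "\<dots> = prob (?E i) * (\<Prod>j\<in>J. prob (?E j))"
    by (rule prod.insert[OF J(2,3)])
  also have "(\<Prod>j\<in>J. prob (?E j)) = prob (\<Inter>j\<in>J. ?E j)"
    using J by (intro indep_varsD[OF indep, symmetric]) auto
  finally show ?thesis unfolding SE vE .
qed

text \<open>Matrices of one common shape are determined by their lists of integer entries.
  Countability allows events about the pair of code and matrix to be sliced by the value of the
  matrix.\<close>

lemma countable_Smat: "countable (range Smat)"
proof (rule countable_image_inj_on)
  let ?f = "\<lambda>S. map (\<lambda>k. map (\<lambda>l. S $$ (k, l)) [0..<n - 1]) [0..<K]"
  show "countable (?f ` range Smat)" by simp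
  show "inj_on ?f (range Smat)"
  proof (rule inj_onI)
    fix S T assume S: "S \<in> range Smat" and T: "T \<in> range Smat" and eq: "?f S = ?f T"
    have "S \<in> carrier_mat K (n - 1)" "T \<in> carrier_mat K (n - 1)"
      using S T Smat_carrier by auto
    then show "S = T" using eq by (intro eq_matI) (auto simp: map_eq_conv)
  qed
qed

lemma joint_event: "{w \<in> space M. P (s i w) (Smat w)} \<in> events"
proof -
  have "{w \<in> space M. P (s i w) (Smat w)} =
      (\<Union>S\<in>range Smat. {w \<in> space M. P (s i w) S} \<inter> {w \<in> space M. Smat w = S})"
    by auto
  also have "\<dots> \<in> events"
    using countable_Smat s_event[OF i_range] Smat_event by (intro sets.countable_UN' sets.Int) auto
  finally show ?thesis .
qed

text \<open>The event is cut first by the value of \<open>s i\<close>, then by that of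
  \<open>Smat\<close>. On each piece membership in the column space is constant, and
  \<open>joint_prob\<close> factors the weight.\<close>

lemma prob_outside_csp:
  "prob {w \<in> space M. real_vec (s i w) \<notin> csp K (Smat w)} =
    (\<Sum>v\<in>supp M (s i). prob {w \<in> space M. s i w = v} *
      (\<Sum>S\<in>supp M Smat. prob {w \<in> space M. Smat w = S} * of_bool (real_vec v \<notin> csp K S)))"
proof -
  let ?P = "\<lambda>v S. real_vec v \<notin> csp K S"
  have ev: "{w \<in> space M. s i w = v \<and> ?P (s i w) (Smat w)} \<in> events" for v
    by (rule joint_event[of "\<lambda>x S. x = v \<and> ?P x S"])
  have ev': "{w \<in> space M. Smat w = S \<and> (s i w = v \<and> ?P (s i w) (Smat w))} \<in> events" for v S
    by (rule joint_event[of "\<lambda>x T. T = S \<and> (x = v \<and> ?P x T)"])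
  have joint: "prob {w \<in> space M. Smat w = S \<and> (s i w = v \<and> ?P (s i w) (Smat w))} =
      prob {w \<in> space M. s i w = v} * (prob {w \<in> space M. Smat w = S} * of_bool (?P v S))" for v S
  proof (cases "?P v S")
    case True
    then have "{w \<in> space M. Smat w = S \<and> (s i w = v \<and> ?P (s i w) (Smat w))} =
        {w \<in> space M. s i w = v \<and> Smat w = S}" by auto
    with True show ?thesis using joint_prob[of v S] by simp
  next
    case False
    then have "{w \<in> space M. Smat w = S \<and> (s i w = v \<and> ?P (s i w) (Smat w))} = {}" by auto
    with False show ?thesis by (simp only: measure_empty) simp
  qed
  have "prob {w \<in> space M. ?P (s i w) (Smat w)} =
      (\<Sum>v\<in>supp M (s i). prob {w \<in> space M. s i w = v \<and> ?P (s i w) (Smat w)})"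
    by (rule prob_by_supp[OF finite_supp_s AE_s_supp ev joint_event])
  also have "\<dots> = (\<Sum>v\<in>supp M (s i). \<Sum>S\<in>supp M Smat.
      prob {w \<in> space M. Smat w = S \<and> (s i w = v \<and> ?P (s i w) (Smat w))})"
    by (intro sum.cong refl prob_by_supp[OF finite_supp_Smat AE_Smat_supp ev' ev])
  finally show ?thesis unfolding joint by (simp add: sum_distrib_left)
qed

end

section \<open>The limit\<close>

theorem proposition1:
  fixes M :: "'w measure"
    and K n i :: nat
    and A :: "int set"
    and p :: "int pmf"
    and \<epsilon> \<beta> :: real
    and s :: "nat \<Rightarrow> 'w \<Rightarrow> int vec"
    and h :: "nat \<Rightarrow> complex"
    and G :: "real vec \<Rightarrow> real mat"
  assumes "prob_space M"
    and "K \<ge> 1"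
    and "finite A" and "0 \<notin> A" and "uminus ` A = A"
    and "set_pmf p \<subseteq> A"
    and "0 < \<epsilon>" and "\<epsilon> \<le> 1"
    and "n \<ge> 2" and "1 \<le> i" and "i \<le> n"
    and "prob_space.indep_vars M (\<lambda>_. count_space UNIV) s {1..n}"
    and "\<And>j. j \<in> {1..n} \<Longrightarrow>
           distr M (count_space UNIV) (s j) = measure_pmf (code_pmf K p \<epsilon>)"
    and "\<And>j. j \<in> {1..n} \<Longrightarrow> h j \<noteq> 0"
    and "\<beta> > 0" and "\<beta>\<^sup>2 * mean_energy M (s i) = 1"
    and "\<And>v. v \<in> carrier_vec K \<Longrightarrow> v \<noteq> 0\<^sub>v K \<Longrightarrow> is_complement K v (G v)"
  shows "((\<lambda>\<gamma>. C_lb M K n i h s \<beta> G \<gamma> / log 2 \<gamma>) \<longlongrightarrow>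
           measure M {w \<in> space M. real_vec (s i w) \<notin> csp K (code_mat K n i s w)} / real K)
         at_top"
proof -
  have fin: "finite (set_pmf (code_pmf K p \<epsilon>))"
    using assms(3,6) finite_subset by (intro finite_set_code_pmf) blast
  interpret codes M K n i s "code_pmf K p \<epsilon>"
    using assms(1,9-13) fin set_code_pmf_carrier by (intro codes.intro codes_axioms.intro) auto
  define \<E> where "\<E> = mean_energy M (s i)"
  \<comment> \<open>Positivity of the mean energy comes from the normalisation of
    \<open>\<beta>\<close>.\<close>
  have \<E>: "\<E> > 0"
    using assms(15,16) zero_less_mult_pos[of "\<beta>\<^sup>2" \<E>] unfolding \<E>_def by simp
  define H where "H = discrete_entropy M (interference_cov K n i h s)"
  define P where "P S = prob {w \<in> space M. Smat w = S}" for S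
  define \<Phi> where "\<Phi> v \<gamma> = 2 powr - H * varrho M K n i h s \<beta> G \<gamma> (real_vec v)" for v \<gamma>
  \<comment> \<open>By independence this is the probability that the fixed vector \<open>v\<close>
    is outside the random column space; it will be the growth exponent of the summand of
    \<open>v\<close>.\<close>
  define e where "e v = (\<Sum>S\<in>supp M Smat. P S * of_bool (real_vec v \<notin> csp K S))" for v
  have sumP: "(\<Sum>S\<in>supp M Smat. P S) = 1"
    unfolding P_def by (intro sum_supp_eq_1 finite_supp_Smat AE_Smat_supp Smat_event)
  have gain: "h (others n i ! l) \<noteq> 0" if "l < n - 1" for l
    using others_le[OF that] assms(14) by blast
  have summand_lim: "((\<lambda>\<gamma>. log 2 (\<Phi> v \<gamma> + 1) / log 2 \<gamma>) \<longlongrightarrow> e v) at_top"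
    if v: "v \<in> supp M (s i) - {0\<^sub>v K}" for v
  proof -
    have vc: "real_vec v \<in> carrier_vec K" using v supp_s_carrier by auto
    have v0: "real_vec v \<noteq> 0\<^sub>v K"
    proof
      assume eq: "real_vec v = 0\<^sub>v K"
      have "v = 0\<^sub>v K"
      proof (rule eq_vecI)
        fix k assume k: "k < dim_vec (0\<^sub>v K :: int vec)"
        then have "real_vec v $ k = 0" by (simp add: eq)
        then show "v $ k = 0\<^sub>v K $ k" using k vc by simp
      qed (use vc in simp)
      with v show False by simp
    qed
    let ?r = "\<lambda>S \<gamma>. det_ratio K (G (real_vec v)) S (gain_mat n i h) (\<beta>\<^sup>2 * \<gamma>)"
    have r_pos: "?r S \<gamma> > 0" if "S \<in> supp M Smat" "\<gamma> > 0" for S \<gamma>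
      unfolding gain_mat_def using that(2) assms(15)
      by (intro det_ratio_pos[OF assms(2) vc v0 assms(17)[OF vc v0] supp_Smat_carrier[OF that(1)] gain]) simp_all
    have r_lim: "((\<lambda>\<gamma>. log 2 (?r S \<gamma>) / log 2 \<gamma>) \<longlongrightarrow> - of_bool (real_vec v \<in> csp K S)) at_top"
      if "S \<in> supp M Smat" for S
      unfolding gain_mat_def using assms(15)
      by (intro log_det_ratio_tendsto[OF assms(2) vc v0 assms(17)[OF vc v0] supp_Smat_carrier[OF that] gain]) simp_all
    \<comment> \<open>\<open>C\<close> collects all factors without \<open>\<gamma>\<close>; the
      entropy enters only here, through a positive constant.\<close>
    define C where "C = 2 powr - H * ((cmod (h i))\<^sup>2 * (vec_norm (real_vec v))\<^sup>2 / \<E>)"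
    have "real_vec v \<bullet> real_vec v > 0" using scalar_prod_self_pos[OF vc v0] .
    then have C: "C > 0"
      unfolding C_def using \<E> assms(14)[OF i_range] by (simp add: vec_norm_def)
    have \<Phi>_eq: "\<Phi> v = (\<lambda>\<gamma>. C * \<gamma> * (\<Prod>S\<in>supp M Smat. ?r S \<gamma> powr P S))"
      by (rule ext) (simp add: \<Phi>_def varrho_def C_def P_def \<E>_def det_ratio_def)
    have "((\<lambda>\<gamma>. log 2 (\<Phi> v \<gamma>) / log 2 \<gamma>) \<longlongrightarrow>
        1 + (\<Sum>S\<in>supp M Smat. P S * - of_bool (real_vec v \<in> csp K S))) at_top"
      unfolding \<Phi>_eq by (intro log_weighted_prod_tendsto finite_supp_Smat C r_pos r_lim)
    \<comment> \<open>The 1 is written as the sum of the weights \<open>P S\<close>, so that each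
      term becomes the weight of the complementary event.\<close>
    also have "1 + (\<Sum>S\<in>supp M Smat. P S * - of_bool (real_vec v \<in> csp K S)) = e v"
      unfolding e_def sumP[symmetric] sum.distrib[symmetric] by (intro sum.cong) auto
    finally have lim: "((\<lambda>\<gamma>. log 2 (\<Phi> v \<gamma>) / log 2 \<gamma>) \<longlongrightarrow> e v) at_top" .
    have "\<forall>\<^sub>F \<gamma> in at_top. \<Phi> v \<gamma> > 0"
      using eventually_gt_at_top[of 0]
    proof eventually_elim
      case (elim \<gamma>)
      then have "0 < ?r S \<gamma> powr P S" if "S \<in> supp M Smat" for S
        using r_pos[OF that, of \<gamma>] by simp
      with C elim show ?case unfolding \<Phi>_eq by (intro mult_pos_pos prod_pos) auto
    qed
    moreover have "e v \<ge> 0" unfolding e_def P_def by (intro sum_nonneg) simp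
    ultimately show ?thesis using lim by (intro log_plus_one_ratio_tendsto)
  qed
  \<comment> \<open>\<open>C_lb\<close> omits the zero code, while \<open>prob_outside_csp\<close>
    sums over the whole support. The sums agree because the zero vector lies in every column
    space.\<close>
  have csp0: "e (0\<^sub>v K) = 0"
  proof -
    have "real_vec (0\<^sub>v K) \<in> csp K S" if "S \<in> supp M Smat" for S
    proof -
      have "map_mat real_of_int S \<in> carrier_mat K (n - 1)" using supp_Smat_carrier[OF that] by simp
      moreover have "map_mat real_of_int S *\<^sub>v 0\<^sub>v (n - 1) = 0\<^sub>v K"
        using supp_Smat_carrier[OF that] by (intro eq_vecI) auto
      moreover have "real_vec (0\<^sub>v K) = 0\<^sub>v K" by (rule eq_vecI) auto
      ultimately show ?thesis
        unfolding csp_def by (auto simp: vec_space.col_space_eq intro!: bexI[of _ "0\<^sub>v (n - 1)"])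
    qed
    then show ?thesis by (simp add: e_def)
  qed
  have "prob {w \<in> space M. real_vec (s i w) \<notin> csp K (Smat w)} =
      (\<Sum>v\<in>supp M (s i). prob {w \<in> space M. s i w = v} * e v)"
    unfolding prob_outside_csp e_def P_def ..
  also have "\<dots> = (\<Sum>v\<in>supp M (s i) - {0\<^sub>v K}. prob {w \<in> space M. s i w = v} * e v)"
    using finite_supp_s csp0 by (intro sum.mono_neutral_right) auto
  finally have prob_eq: "prob {w \<in> space M. real_vec (s i w) \<notin> csp K (Smat w)} =
      (\<Sum>v\<in>supp M (s i) - {0\<^sub>v K}. prob {w \<in> space M. s i w = v} * e v)" .
  have "((\<lambda>\<gamma>. 1 / real K * (\<Sum>v\<in>supp M (s i) - {0\<^sub>v K}.
        prob {w \<in> space M. s i w = v} * (log 2 (\<Phi> v \<gamma> + 1) / log 2 \<gamma>))) \<longlongrightarrow>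
      1 / real K * (\<Sum>v\<in>supp M (s i) - {0\<^sub>v K}. prob {w \<in> space M. s i w = v} * e v)) at_top"
    by (intro tendsto_intros summand_lim)
  then show ?thesis
    unfolding prob_eq by (simp add: C_lb_def \<Phi>_def H_def sum_divide_distrib mult.commute[of "real K"])
qed

end
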